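(* Let $\mathscr M$ be a $2$-category which is a special Quillen algebra (a monoidal category being regarded as a one-object $2$-category). There is an equivalence between the following data: (1) an $\mathscr M$-semi-category (with a small set of objects $X$); (2) a strict Co-Segal $\mathbb S_{\overline X}$-diagram of $\mathscr M$ (for a set $X$).
   Context: Composition of $1$-morphisms (and horizontal composition of $2$-morphisms) in $\mathscr M$ is denoted $\otimes$, written in diagrammatic order. The $2$-category $\mathscr M$ is a special Quillen algebra (for the operad whose algebras are $2$-categories) if: every category $\mathscr M(U,V)$ is complete and cocomplete, and $\otimes$ preserves colimits in each variable; every $\mathscr M(U,V)$ is a closed model category; and for every composable tuple $(g_1,\dots,g_n)$ of $2$-morphisms with cofibrant domains, $g_1\otimes\cdots\otimes g_n$ is a cofibration (resp. trivial cofibration) if all the $g_k$ are cofibrations (resp. trivial cofibrations). An $\mathscr M$-semi-category $\mathscr A$ with object set $X$ is given by the data and axioms of an $\mathscr M$-category without the identities: each $A\in X$ lies over an object of $\mathscr M$ (also written $A$), there are $1$-morphisms $\mathscr A(A,B)\in\mathscr M(A,B)$ and composition $2$-morphisms $\mathscr A(A,B)\otimes\mathscr A(B,C)\to\mathscr A(A,C)$, satisfying associativity. For a nonempty set $X$ and $A,B\in X$, let $\mathbb S_{\overline X}(A,B)$ be the category whose objects are finite sequences $t=(E_0,\dots,E_n)$ of elements of $X$ with $n\ge1$, $E_0=A$, $E_n=B$, and whose morphisms $(E_0,\dots,E_n)\to(E'_0,\dots,E'_m)$ are surjective nondecreasing maps $f:\{0,\dots,n-1\}\to\{0,\dots,m-1\}$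 with $E'_j=E_{\min f^{-1}(j)}$ for $0\le j<m$. Concatenation of sequences (and ordinal sum of maps) gives strictly associative functors $\otimes:\mathbb S_{\overline X}(A,B)\times\mathbb S_{\overline X}(B,C)\to\mathbb S_{\overline X}(A,C)$, making $\mathbb S_{\overline X}$ a strict semi-$2$-category (no identity $1$-morphisms) with object set $X$. The superscript $2$-op means that $2$-cells are reversed. An $\mathbb S_{\overline X}$-diagram of $\mathscr M$ is a lax morphism $F:(\mathbb S_{\overline X})^{2\text{-op}}\to\mathscr M$: a function $A\mapsto FA$ to objects of $\mathscr M$, functors $F_{AB}:\mathbb S_{\overline X}(A,B)^{op}\to\mathscr M(FA,FB)$ and natural laxity $2$-morphisms $\varphi_{s,t}:F(s)\otimes F(t)\to F(s\otimes t)$ satisfying the associativity coherence condition (no unit data). It is a strict Co-Segal $\mathbb S_{\overline X}$-diagram if $F_{AB}(u)$ is an invertible $2$-morphism for every morphism $u$ of every $\mathbb S_{\overline X}(A,B)$. *)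

theory Defs
  imports "HOL-Library.FuncSet"
begin

section \<open>Categories with explicit carriers\<close>

record ('o, 'm) cat =
  Obj :: "'o set"
  Arr :: "'m set"
  Dom :: "'m \<Rightarrow> 'o"
  Cod :: "'m \<Rightarrow> 'o"
  Id :: "'o \<Rightarrow> 'm"
  Comp :: "'m \<Rightarrow> 'm \<Rightarrow> 'm"  (infixl "\<cdot>\<index>" 70)
    \<comment> \<open>applicative order: \<open>g \<cdot> f\<close> is \<open>g\<close> after \<open>f\<close>\<close>

definition hom :: "('o, 'm, 'z) cat_scheme \<Rightarrow> 'o \<Rightarrow> 'o \<Rightarrow> 'm set" where
  "hom C x y = {f \<in> Arr C. Dom C f = x \<and> Cod C f = y}"

locale category =
  fixes C :: "('o, 'm, 'z) cat_scheme" (structure)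
  assumes Dom_Obj: "f \<in> Arr C \<Longrightarrow> Dom C f \<in> Obj C"
    and Cod_Obj: "f \<in> Arr C \<Longrightarrow> Cod C f \<in> Obj C"
    and Id_hom: "x \<in> Obj C \<Longrightarrow> Id C x \<in> hom C x x"
    and Comp_hom: "\<lbrakk>f \<in> hom C x y; g \<in> hom C y z\<rbrakk> \<Longrightarrow> g \<cdot> f \<in> hom C x z"
    and Comp_Id: "f \<in> hom C x y \<Longrightarrow> f \<cdot> Id C x = f"
    and Id_Comp: "f \<in> hom C x y \<Longrightarrow> Id C y \<cdot> f = f"
    and Comp_assoc: "\<lbrakk>f \<in> hom C w x; g \<in> hom C x y; h \<in> hom C y z\<rbrakk>
        \<Longrightarrow> (h \<cdot> g) \<cdot> f = h \<cdot> (g \<cdot> f)"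

definition op_cat :: "('o, 'm) cat \<Rightarrow> ('o, 'm) cat" where
  "op_cat C = \<lparr>Obj = Obj C, Arr = Arr C, Dom = Cod C, Cod = Dom C, Id = Id C,
               Comp = (\<lambda>g f. Comp C f g)\<rparr>"

definition is_iso :: "('o, 'm, 'z) cat_scheme \<Rightarrow> 'm \<Rightarrow> bool" where
  "is_iso C f \<longleftrightarrow> f \<in> Arr C \<and>
     (\<exists>g \<in> hom C (Cod C f) (Dom C f).
        Comp C g f = Id C (Dom C f) \<and> Comp C f g = Id C (Cod C f))"

record ('o, 'm, 'p, 'n) ftor =
  omap :: "'o \<Rightarrow> 'p"
  amap :: "'m \<Rightarrow> 'n"

definition is_functor ::
  "('o, 'm, 'y) cat_scheme \<Rightarrow> ('p, 'n, 'z) cat_scheme \<Rightarrow> ('o, 'm, 'p, 'n) ftor \<Rightarrow> bool" where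
  "is_functor C D F \<longleftrightarrow>
     (\<forall>x \<in> Obj C. omap F x \<in> Obj D) \<and>
     (\<forall>f \<in> Arr C. amap F f \<in> hom D (omap F (Dom C f)) (omap F (Cod C f))) \<and>
     (\<forall>x \<in> Obj C. amap F (Id C x) = Id D (omap F x)) \<and>
     (\<forall>f \<in> Arr C. \<forall>g \<in> Arr C. Cod C f = Dom C g \<longrightarrow>
        amap F (Comp C g f) = Comp D (amap F g) (amap F f))"

definition id_ftor :: "('o, 'm, 'o, 'm) ftor" where
  "id_ftor = \<lparr>omap = (\<lambda>x. x), amap = (\<lambda>f. f)\<rparr>"

definition comp_ftor ::
  "('p, 'n, 'q, 'k) ftor \<Rightarrow> ('o, 'm, 'p, 'n) ftor \<Rightarrow> ('o, 'm, 'q, 'k) ftor" where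
  "comp_ftor G F = \<lparr>omap = omap G \<circ> omap F, amap = amap G \<circ> amap F\<rparr>"

definition nat_iso ::
  "('o, 'm, 'y) cat_scheme \<Rightarrow> ('p, 'n, 'z) cat_scheme \<Rightarrow>
   ('o, 'm, 'p, 'n) ftor \<Rightarrow> ('o, 'm, 'p, 'n) ftor \<Rightarrow> ('o \<Rightarrow> 'n) \<Rightarrow> bool" where
  "nat_iso C D F G \<eta> \<longleftrightarrow>
     (\<forall>x \<in> Obj C. \<eta> x \<in> hom D (omap F x) (omap G x) \<and> is_iso D (\<eta> x)) \<and>
     (\<forall>f \<in> Arr C. Comp D (amap G f) (\<eta> (Dom C f)) = Comp D (\<eta> (Cod C f)) (amap F f))"

definition is_equivalence ::
  "('o, 'm, 'y) cat_scheme \<Rightarrow> ('p, 'n, 'z) cat_scheme \<Rightarrow>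
   ('o, 'm, 'p, 'n) ftor \<Rightarrow> ('p, 'n, 'o, 'm) ftor \<Rightarrow> ('o \<Rightarrow> 'm) \<Rightarrow> ('p \<Rightarrow> 'n) \<Rightarrow> bool" where
  "is_equivalence C D \<Phi> \<Psi> \<eta> \<epsilon> \<longleftrightarrow>
     category C \<and> category D \<and> is_functor C D \<Phi> \<and> is_functor D C \<Psi> \<and>
     nat_iso C C id_ftor (comp_ftor \<Psi> \<Phi>) \<eta> \<and>
     nat_iso D D (comp_ftor \<Phi> \<Psi>) id_ftor \<epsilon>"


section \<open>Limits and colimits\<close>

definition is_cone ::
  "('o, 'm) cat \<Rightarrow> ('j, 'k) cat \<Rightarrow> ('j, 'k, 'o, 'm) ftor \<Rightarrow> 'o \<Rightarrow> ('j \<Rightarrow> 'm) \<Rightarrow> bool" where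
  "is_cone C J D c l \<longleftrightarrow> c \<in> Obj C \<and>
     (\<forall>j \<in> Obj J. l j \<in> hom C c (omap D j)) \<and>
     (\<forall>u \<in> Arr J. Comp C (amap D u) (l (Dom J u)) = l (Cod J u))"

definition is_limit ::
  "('o, 'm) cat \<Rightarrow> ('j, 'k) cat \<Rightarrow> ('j, 'k, 'o, 'm) ftor \<Rightarrow> 'o \<Rightarrow> ('j \<Rightarrow> 'm) \<Rightarrow> bool" where
  "is_limit C J D c l \<longleftrightarrow> is_cone C J D c l \<and>
     (\<forall>d k. is_cone C J D d k \<longrightarrow>
        (\<exists>!h. h \<in> hom C d c \<and> (\<forall>j \<in> Obj J. Comp C (l j) h = k j)))"

definition is_colimit ::
  "('o, 'm) cat \<Rightarrow> ('j, 'k) cat \<Rightarrow> ('j, 'k, 'o, 'm) ftor \<Rightarrow> 'o \<Rightarrow> ('j \<Rightarrow> 'm) \<Rightarrow> bool" where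
  "is_colimit C J D c l \<longleftrightarrow> is_limit (op_cat C) (op_cat J) D c l"

text \<open>
  The type argument plays the role of the universe: a small category is one whose objects and
  arrows are elements of \<open>'x\<close>, and a small set is a subset of \<open>'x\<close>.
\<close>

definition complete_cat :: "'x itself \<Rightarrow> ('o, 'm) cat \<Rightarrow> bool" where
  "complete_cat _ C \<longleftrightarrow>
     (\<forall>(J :: ('x, 'x) cat) D. category J \<and> is_functor J C D \<longrightarrow> (\<exists>c l. is_limit C J D c l))"

definition cocomplete_cat :: "'x itself \<Rightarrow> ('o, 'm) cat \<Rightarrow> bool" where
  "cocomplete_cat _ C \<longleftrightarrow>
     (\<forall>(J :: ('x, 'x) cat) D. category J \<and> is_functor J C D \<longrightarrow> (\<exists>c l. is_colimit C J D c l))"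

definition preserves_colimits ::
  "'x itself \<Rightarrow> ('o, 'm) cat \<Rightarrow> ('p, 'n) cat \<Rightarrow> ('o, 'm, 'p, 'n) ftor \<Rightarrow> bool" where
  "preserves_colimits _ C D F \<longleftrightarrow>
     (\<forall>(J :: ('x, 'x) cat) K c l. category J \<and> is_functor J C K \<and> is_colimit C J K c l \<longrightarrow>
        is_colimit D J (comp_ftor F K) (omap F c) (amap F \<circ> l))"


section \<open>Closed model categories\<close>

definition is_retract :: "('o, 'm) cat \<Rightarrow> 'm \<Rightarrow> 'm \<Rightarrow> bool" where
  "is_retract C f g \<longleftrightarrow>
     (\<exists>i \<in> hom C (Dom C f) (Dom C g). \<exists>r \<in> hom C (Dom C g) (Dom C f).
      \<exists>i' \<in> hom C (Cod C f) (Cod C g). \<exists>r' \<in> hom C (Cod C g) (Cod C f).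
        Comp C r i = Id C (Dom C f) \<and> Comp C r' i' = Id C (Cod C f) \<and>
        Comp C g i = Comp C i' f \<and> Comp C f r = Comp C r' g)"

definition has_lift :: "('o, 'm) cat \<Rightarrow> 'm \<Rightarrow> 'm \<Rightarrow> bool" where
  "has_lift C i p \<longleftrightarrow>
     (\<forall>a \<in> hom C (Dom C i) (Dom C p). \<forall>b \<in> hom C (Cod C i) (Cod C p).
        Comp C p a = Comp C b i \<longrightarrow>
        (\<exists>h \<in> hom C (Cod C i) (Dom C p). Comp C h i = a \<and> Comp C p h = b))"

text \<open>
  Quillen's axioms CM1--CM5 for the classes \<open>W\<close> of weak equivalences, \<open>K\<close> of cofibrations and
  \<open>F\<close> of fibrations. Every finite category is isomorphic to one on natural numbers, which is
  why the finite diagrams of CM1 are indexed by such categories.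
\<close>

locale closed_model_category = category C
  for C :: "('o, 'm) cat" (structure) and W K F :: "'m set" +
  assumes classes: "W \<subseteq> Arr C" "K \<subseteq> Arr C" "F \<subseteq> Arr C"
    and CM1_lim: "\<lbrakk>category (J :: (nat, nat) cat); finite (Obj J); finite (Arr J);
        is_functor J C D\<rbrakk> \<Longrightarrow> \<exists>c l. is_limit C J D c l"
    and CM1_colim: "\<lbrakk>category (J :: (nat, nat) cat); finite (Obj J); finite (Arr J);
        is_functor J C D\<rbrakk> \<Longrightarrow> \<exists>c l. is_colimit C J D c l"
    and CM2_comp: "\<lbrakk>f \<in> hom C x y; g \<in> hom C y z; f \<in> W; g \<in> W\<rbrakk> \<Longrightarrow> g \<cdot> f \<in> W"
    and CM2_left: "\<lbrakk>f \<in> hom C x y; g \<in> hom C y z; f \<in> W; g \<cdot> f \<in> W\<rbrakk> \<Longrightarrow> g \<in> W"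
    and CM2_right: "\<lbrakk>f \<in> hom C x y; g \<in> hom C y z; g \<in> W; g \<cdot> f \<in> W\<rbrakk> \<Longrightarrow> f \<in> W"
    and CM3: "\<lbrakk>f \<in> Arr C; T \<in> {W, K, F}; g \<in> T; is_retract C f g\<rbrakk> \<Longrightarrow> f \<in> T"
    and CM4_cof: "\<lbrakk>i \<in> K; p \<in> F \<inter> W\<rbrakk> \<Longrightarrow> has_lift C i p"
    and CM4_fib: "\<lbrakk>i \<in> K \<inter> W; p \<in> F\<rbrakk> \<Longrightarrow> has_lift C i p"
    and CM5_cof: "f \<in> hom C x y \<Longrightarrow>
        \<exists>z. \<exists>i \<in> hom C x z \<inter> K. \<exists>p \<in> hom C z y \<inter> (F \<inter> W). f = p \<cdot> i"
    and CM5_fib: "f \<in> hom C x y \<Longrightarrow>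
        \<exists>z. \<exists>i \<in> hom C x z \<inter> (K \<inter> W). \<exists>p \<in> hom C z y \<inter> F. f = p \<cdot> i"

definition initial_obj :: "('o, 'm) cat \<Rightarrow> 'o \<Rightarrow> bool" where
  "initial_obj C z \<longleftrightarrow> z \<in> Obj C \<and> (\<forall>c \<in> Obj C. \<exists>!h. h \<in> hom C z c)"

definition cofibrant :: "('o, 'm) cat \<Rightarrow> 'm set \<Rightarrow> 'o \<Rightarrow> bool" where
  "cofibrant C K c \<longleftrightarrow> c \<in> Obj C \<and> (\<exists>z. initial_obj C z \<and> (\<exists>h \<in> hom C z c. h \<in> K))"


section \<open>Two-dimensional structures\<close>

text \<open>Horizontal composition is in diagrammatic order, vertical composition in applicative order.\<close>

record ('u, 'f, 'a) semi2 =
  Ob :: "'u set"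
  Mor1 :: "'f set"
  src :: "'f \<Rightarrow> 'u"
  trg :: "'f \<Rightarrow> 'u"
  Mor2 :: "'a set"
  dom2 :: "'a \<Rightarrow> 'f"
  cod2 :: "'a \<Rightarrow> 'f"
  id2 :: "'f \<Rightarrow> 'a"
  vcomp :: "'a \<Rightarrow> 'a \<Rightarrow> 'a"  (infixl "\<bullet>\<index>" 70)
  tens1 :: "'f \<Rightarrow> 'f \<Rightarrow> 'f"  (infixl "\<otimes>\<index>" 75)
  tens2 :: "'a \<Rightarrow> 'a \<Rightarrow> 'a"  (infixl "\<star>\<index>" 75)

definition Hom1 :: "('u, 'f, 'a, 'z) semi2_scheme \<Rightarrow> 'u \<Rightarrow> 'u \<Rightarrow> 'f set" where
  "Hom1 S U V = {f \<in> Mor1 S. src S f = U \<and> trg S f = V}"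

definition Hom2 :: "('u, 'f, 'a, 'z) semi2_scheme \<Rightarrow> 'f \<Rightarrow> 'f \<Rightarrow> 'a set" where
  "Hom2 S f g = {a \<in> Mor2 S. dom2 S a = f \<and> cod2 S a = g}"

definition Hom :: "('u, 'f, 'a, 'z) semi2_scheme \<Rightarrow> 'u \<Rightarrow> 'u \<Rightarrow> ('f, 'a) cat" where
  "Hom S U V = \<lparr>Obj = Hom1 S U V, Arr = {a \<in> Mor2 S. dom2 S a \<in> Hom1 S U V},
                Dom = dom2 S, Cod = cod2 S, Id = id2 S, Comp = vcomp S\<rparr>"

text \<open>
  The data common to strict semi-2-categories and bicategories: hom categories and functorial
  horizontal composition.
\<close>

locale pre_2_category =
  fixes S :: "('u, 'f, 'a, 'z) semi2_scheme" (structure)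
  assumes src_trg: "f \<in> Mor1 S \<Longrightarrow> src S f \<in> Ob S \<and> trg S f \<in> Ob S"
    and dom2_cod2: "a \<in> Mor2 S \<Longrightarrow> dom2 S a \<in> Mor1 S \<and> cod2 S a \<in> Mor1 S \<and>
        src S (dom2 S a) = src S (cod2 S a) \<and> trg S (dom2 S a) = trg S (cod2 S a)"
    and category_Hom: "\<lbrakk>U \<in> Ob S; V \<in> Ob S\<rbrakk> \<Longrightarrow> category (Hom S U V)"
    and tens1_Hom: "\<lbrakk>f \<in> Hom1 S U V; g \<in> Hom1 S V W\<rbrakk> \<Longrightarrow> f \<otimes> g \<in> Hom1 S U W"
    and tens2_Hom: "\<lbrakk>f \<in> Hom1 S U V; g \<in> Hom1 S V W; a \<in> Hom2 S f f'; b \<in> Hom2 S g g'\<rbrakk>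
        \<Longrightarrow> a \<star> b \<in> Hom2 S (f \<otimes> g) (f' \<otimes> g')"
    and tens2_id: "\<lbrakk>f \<in> Hom1 S U V; g \<in> Hom1 S V W\<rbrakk>
        \<Longrightarrow> id2 S f \<star> id2 S g = id2 S (f \<otimes> g)"
    and interchange: "\<lbrakk>f \<in> Hom1 S U V; g \<in> Hom1 S V W; a \<in> Hom2 S f f'; a' \<in> Hom2 S f' f'';
        b \<in> Hom2 S g g'; b' \<in> Hom2 S g' g''\<rbrakk>
        \<Longrightarrow> (a' \<bullet> a) \<star> (b' \<bullet> b) = (a' \<star> b') \<bullet> (a \<star> b)"

locale semi_2_category = pre_2_category +
  assumes tens1_assoc: "\<lbrakk>f \<in> Hom1 S T U; g \<in> Hom1 S U V; h \<in> Hom1 S V W\<rbrakk>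
        \<Longrightarrow> (f \<otimes> g) \<otimes> h = f \<otimes> (g \<otimes> h)"
    and tens2_assoc: "\<lbrakk>f \<in> Hom1 S T U; g \<in> Hom1 S U V; h \<in> Hom1 S V W;
        a \<in> Hom2 S f f'; b \<in> Hom2 S g g'; c \<in> Hom2 S h h'\<rbrakk>
        \<Longrightarrow> (a \<star> b) \<star> c = a \<star> (b \<star> c)"

definition two_op :: "('u, 'f, 'a) semi2 \<Rightarrow> ('u, 'f, 'a) semi2" where
  "two_op S = S\<lparr>dom2 := cod2 S, cod2 := dom2 S, vcomp := (\<lambda>b a. vcomp S a b)\<rparr>"

record ('u, 'f, 'a) bicat = "('u, 'f, 'a) semi2" +
  unit1 :: "'u \<Rightarrow> 'f"
  associator :: "'f \<Rightarrow> 'f \<Rightarrow> 'f \<Rightarrow> 'a"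
  lunitor :: "'f \<Rightarrow> 'a"
  runitor :: "'f \<Rightarrow> 'a"

text \<open>
  2-categories are taken in the weak sense, so that arbitrary monoidal categories are the
  one-object case; a strict 2-category is the case of identity associator and unitors.
\<close>

locale bicategory = pre_2_category M
  for M :: "('u, 'f, 'a, 'z) bicat_scheme" (structure) +
  assumes unit1_Hom: "U \<in> Ob M \<Longrightarrow> unit1 M U \<in> Hom1 M U U"
    and associator_Hom: "\<lbrakk>f \<in> Hom1 M T U; g \<in> Hom1 M U V; h \<in> Hom1 M V W\<rbrakk>
        \<Longrightarrow> associator M f g h \<in> Hom2 M ((f \<otimes> g) \<otimes> h) (f \<otimes> (g \<otimes> h)) \<and>
            is_iso (Hom M T W) (associator M f g h)"
    and associator_natural: "\<lbrakk>f \<in> Hom1 M T U; g \<in> Hom1 M U V; h \<in> Hom1 M V W;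
        a \<in> Hom2 M f f'; b \<in> Hom2 M g g'; c \<in> Hom2 M h h'\<rbrakk>
        \<Longrightarrow> associator M f' g' h' \<bullet> ((a \<star> b) \<star> c) = (a \<star> (b \<star> c)) \<bullet> associator M f g h"
    and lunitor_Hom: "f \<in> Hom1 M U V
        \<Longrightarrow> lunitor M f \<in> Hom2 M (unit1 M U \<otimes> f) f \<and> is_iso (Hom M U V) (lunitor M f)"
    and lunitor_natural: "\<lbrakk>f \<in> Hom1 M U V; a \<in> Hom2 M f f'\<rbrakk>
        \<Longrightarrow> lunitor M f' \<bullet> (id2 M (unit1 M U) \<star> a) = a \<bullet> lunitor M f"
    and runitor_Hom: "f \<in> Hom1 M U V
        \<Longrightarrow> runitor M f \<in> Hom2 M (f \<otimes> unit1 M V) f \<and> is_iso (Hom M U V) (runitor M f)"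
    and runitor_natural: "\<lbrakk>f \<in> Hom1 M U V; a \<in> Hom2 M f f'\<rbrakk>
        \<Longrightarrow> runitor M f' \<bullet> (a \<star> id2 M (unit1 M V)) = a \<bullet> runitor M f"
    and pentagon: "\<lbrakk>f \<in> Hom1 M T U; g \<in> Hom1 M U V; h \<in> Hom1 M V W; k \<in> Hom1 M W Y\<rbrakk>
        \<Longrightarrow> (id2 M f \<star> associator M g h k) \<bullet> associator M f (g \<otimes> h) k
              \<bullet> (associator M f g h \<star> id2 M k)
            = associator M f g (h \<otimes> k) \<bullet> associator M (f \<otimes> g) h k"
    and triangle: "\<lbrakk>f \<in> Hom1 M U V; g \<in> Hom1 M V W\<rbrakk>
        \<Longrightarrow> (id2 M f \<star> lunitor M g) \<bullet> associator M f (unit1 M V) g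
            = runitor M f \<star> id2 M g"


section \<open>Special Quillen algebras\<close>

definition composable_list :: "('u, 'f, 'a, 'z) semi2_scheme \<Rightarrow> 'a list \<Rightarrow> bool" where
  "composable_list S gs \<longleftrightarrow> gs \<noteq> [] \<and> set gs \<subseteq> Mor2 S \<and>
     successively (\<lambda>a b. trg S (dom2 S a) = src S (dom2 S b)) gs"

text \<open>
  Bracketed to the left. Other bracketings yield isomorphic arrows, so the choice does not affect
  membership in the classes of a closed model category.
\<close>

definition tens_list :: "('u, 'f, 'a, 'z) semi2_scheme \<Rightarrow> 'a list \<Rightarrow> 'a" where
  "tens_list S gs = foldl (tens2 S) (hd gs) (tl gs)"

text \<open>
  \<open>W\<close>, \<open>K\<close>, \<open>F\<close> are the classes of weak equivalences, cofibrations and fibrations of all hom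
  categories together.
\<close>

locale special_quillen_algebra = bicategory M
  for univ :: "'x itself"
    and M :: "('u, 'f, 'a) bicat" (structure)
    and W K F :: "'a set" +
  assumes complete: "\<lbrakk>U \<in> Ob M; V \<in> Ob M\<rbrakk> \<Longrightarrow> complete_cat univ (Hom M U V)"
    and cocomplete: "\<lbrakk>U \<in> Ob M; V \<in> Ob M\<rbrakk> \<Longrightarrow> cocomplete_cat univ (Hom M U V)"
    and tens_left_colimits: "\<lbrakk>f \<in> Hom1 M T U; V \<in> Ob M\<rbrakk> \<Longrightarrow>
        preserves_colimits univ (Hom M U V) (Hom M T V)
          \<lparr>omap = (\<lambda>g. f \<otimes> g), amap = (\<lambda>b. id2 M f \<star> b)\<rparr>"
    and tens_right_colimits: "\<lbrakk>g \<in> Hom1 M U V; T \<in> Ob M\<rbrakk> \<Longrightarrow>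
        preserves_colimits univ (Hom M T U) (Hom M T V)
          \<lparr>omap = (\<lambda>f. f \<otimes> g), amap = (\<lambda>a. a \<star> id2 M g)\<rparr>"
    and classes_Mor2: "W \<subseteq> Mor2 M" "K \<subseteq> Mor2 M" "F \<subseteq> Mor2 M"
    and model: "\<lbrakk>U \<in> Ob M; V \<in> Ob M\<rbrakk> \<Longrightarrow>
        closed_model_category (Hom M U V)
          (W \<inter> Arr (Hom M U V)) (K \<inter> Arr (Hom M U V)) (F \<inter> Arr (Hom M U V))"
    and tens_cofibrations: "\<lbrakk>composable_list M gs;
        \<And>g. g \<in> set gs \<Longrightarrow>
          cofibrant (Hom M (src M (dom2 M g)) (trg M (dom2 M g))) K (dom2 M g);
        set gs \<subseteq> K\<rbrakk> \<Longrightarrow> tens_list M gs \<in> K"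
    and tens_trivial_cofibrations: "\<lbrakk>composable_list M gs;
        \<And>g. g \<in> set gs \<Longrightarrow>
          cofibrant (Hom M (src M (dom2 M g)) (trg M (dom2 M g))) K (dom2 M g);
        set gs \<subseteq> K \<inter> W\<rbrakk> \<Longrightarrow> tens_list M gs \<in> K \<inter> W"


section \<open>The category of \<open>M\<close>-semi-categories\<close>

text \<open>All families are extensional, so that equality of records is equality of data.\<close>

record ('x, 'u, 'f, 'a) semicat =
  sset :: "'x set"
  sob :: "'x \<Rightarrow> 'u"
  shom :: "'x \<Rightarrow> 'x \<Rightarrow> 'f"
  scomp :: "'x \<Rightarrow> 'x \<Rightarrow> 'x \<Rightarrow> 'a"

locale semi_category =
  fixes M :: "('u, 'f, 'a, 'z) bicat_scheme" (structure)
    and A :: "('x, 'u, 'f, 'a) semicat"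
  assumes sob: "sob A \<in> sset A \<rightarrow>\<^sub>E Ob M"
    and shom: "\<lbrakk>a \<in> sset A; b \<in> sset A\<rbrakk> \<Longrightarrow> shom A a b \<in> Hom1 M (sob A a) (sob A b)"
    and shom_ext: "case_prod (shom A) \<in> extensional (sset A \<times> sset A)"
    and scomp: "\<lbrakk>a \<in> sset A; b \<in> sset A; c \<in> sset A\<rbrakk> \<Longrightarrow>
        scomp A a b c \<in> Hom2 M (shom A a b \<otimes> shom A b c) (shom A a c)"
    and scomp_ext: "(\<lambda>(a, b, c). scomp A a b c) \<in> extensional (sset A \<times> sset A \<times> sset A)"
    and sassoc: "\<lbrakk>a \<in> sset A; b \<in> sset A; c \<in> sset A; d \<in> sset A\<rbrakk> \<Longrightarrow>
        scomp A a c d \<bullet> (scomp A a b c \<star> id2 M (shom A c d))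
        = scomp A a b d \<bullet> (id2 M (shom A a b) \<star> scomp A b c d)
            \<bullet> associator M (shom A a b) (shom A b c) (shom A c d)"

text \<open>
  An arrow between two structures with object sets: a map of object sets together with an indexed
  family of 2-morphisms.
\<close>

record ('d, 'x, 'i, 'a) family_arrow =
  mdom :: 'd
  mcod :: 'd
  mfun :: "'x \<Rightarrow> 'x"
  mfam :: "'i \<Rightarrow> 'a"

locale semi_functor =
  fixes M :: "('u, 'f, 'a, 'z) bicat_scheme" (structure)
    and h :: "(('x, 'u, 'f, 'a) semicat, 'x, 'x \<times> 'x, 'a) family_arrow"
  assumes mdom: "semi_category M (mdom h)"
    and mcod: "semi_category M (mcod h)"
    and mfun: "mfun h \<in> sset (mdom h) \<rightarrow>\<^sub>E sset (mcod h)"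
    and mfun_over: "a \<in> sset (mdom h) \<Longrightarrow> sob (mcod h) (mfun h a) = sob (mdom h) a"
    and mfam: "\<lbrakk>a \<in> sset (mdom h); b \<in> sset (mdom h)\<rbrakk> \<Longrightarrow>
        mfam h (a, b) \<in> Hom2 M (shom (mdom h) a b) (shom (mcod h) (mfun h a) (mfun h b))"
    and mfam_ext: "mfam h \<in> extensional (sset (mdom h) \<times> sset (mdom h))"
    and mfam_comp: "\<lbrakk>a \<in> sset (mdom h); b \<in> sset (mdom h); c \<in> sset (mdom h)\<rbrakk> \<Longrightarrow>
        mfam h (a, c) \<bullet> scomp (mdom h) a b c
        = scomp (mcod h) (mfun h a) (mfun h b) (mfun h c) \<bullet> (mfam h (a, b) \<star> mfam h (b, c))"

definition SemiCat :: "('u, 'f, 'a, 'z) bicat_scheme \<Rightarrow>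
  (('x, 'u, 'f, 'a) semicat,
   (('x, 'u, 'f, 'a) semicat, 'x, 'x \<times> 'x, 'a) family_arrow) cat" where
  "SemiCat M =
    \<lparr>Obj = {A. semi_category M A},
     Arr = {h. semi_functor M h},
     Dom = mdom,
     Cod = mcod,
     Id = (\<lambda>A. \<lparr>mdom = A, mcod = A, mfun = (\<lambda>a \<in> sset A. a),
                mfam = (\<lambda>(a, b) \<in> sset A \<times> sset A. id2 M (shom A a b))\<rparr>),
     Comp = (\<lambda>k h. \<lparr>mdom = mdom h, mcod = mcod k,
                mfun = compose (sset (mdom h)) (mfun k) (mfun h),
                mfam = (\<lambda>(a, b) \<in> sset (mdom h) \<times> sset (mdom h).
                  vcomp M (mfam k (mfun h a, mfun h b)) (mfam h (a, b)))\<rparr>)\<rparr>"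


section \<open>The semi-2-category of sequences in a set\<close>

text \<open>
  The sequence \<open>(E\<^sub>0, \<dots>, E\<^sub>n)\<close> is a list of length \<open>n + 1\<close>, and \<open>arity\<close> is \<open>n\<close>. A 2-morphism
  carries its source and target together with the map on \<open>{..<n}\<close>.
\<close>

definition arity :: "'x list \<Rightarrow> nat" where
  "arity t = length t - 1"

definition seqs :: "'x set \<Rightarrow> 'x list set" where
  "seqs X = {t. 2 \<le> length t \<and> set t \<subseteq> X}"

type_synonym 'x seq_mor = "'x list \<times> 'x list \<times> (nat \<Rightarrow> nat)"

definition seq_mors :: "'x set \<Rightarrow> 'x seq_mor set" where
  "seq_mors X = {(s, t, p). s \<in> seqs X \<and> t \<in> seqs X \<and> hd s = hd t \<and> last s = last t \<and>
     p \<in> {..<arity s} \<rightarrow>\<^sub>E {..<arity t} \<and> mono_on {..<arity s} p \<and>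
     p ` {..<arity s} = {..<arity t} \<and>
     (\<forall>j < arity t. t ! j = s ! Min {i. i < arity s \<and> p i = j})}"

definition concat_seq :: "'x list \<Rightarrow> 'x list \<Rightarrow> 'x list" where
  "concat_seq s t = s @ tl t"

fun ordinal_sum :: "'x seq_mor \<Rightarrow> 'x seq_mor \<Rightarrow> 'x seq_mor" where
  "ordinal_sum (s, t, p) (s', t', p') =
     (concat_seq s s', concat_seq t t',
      (\<lambda>i \<in> {..<arity s + arity s'}. if i < arity s then p i else arity t + p' (i - arity s)))"

definition SX :: "'x set \<Rightarrow> ('x, 'x list, 'x seq_mor) semi2" where
  "SX X =
    \<lparr>Ob = X,
     Mor1 = seqs X,
     src = hd,
     trg = last,
     Mor2 = seq_mors X,
     dom2 = (\<lambda>(s, t, p). s),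
     cod2 = (\<lambda>(s, t, p). t),
     id2 = (\<lambda>s. (s, s, (\<lambda>i \<in> {..<arity s}. i))),
     vcomp = (\<lambda>(t', r, q) (s, t, p). (s, r, compose {..<arity s} q p)),
     tens1 = concat_seq,
     tens2 = ordinal_sum\<rparr>"


lemma Min_fibre:
  assumes "p ` {..<n} = {..<m::nat}" "j < m"
  shows "Min {i. i < (n::nat) \<and> p i = j} < n \<and> p (Min {i. i < n \<and> p i = j}) = j
     \<and> (\<forall>i<n. p i = j \<longrightarrow> Min {i. i < n \<and> p i = j} \<le> i)"
proof -
  have "j \<in> p ` {..<n}" using assms by simp
  then have ne: "{i. i < n \<and> p i = j} \<noteq> {}" by auto
  have "Min {i. i < n \<and> p i = j} \<in> {i. i < n \<and> p i = j}" by (rule Min_in) (use ne in auto)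
  then show ?thesis by (auto intro: Min_le)
qed

lemma Min_fibre_eq:
  assumes "i0 < (n::nat)" "p i0 = j" "\<And>i. i < n \<Longrightarrow> p i = j \<Longrightarrow> i0 \<le> i"
  shows "Min {i. i < n \<and> p i = j} = i0"
  by (rule Min_eqI) (use assms in auto)

lemma seq_mor_iff: "(s,t,p) \<in> seq_mors X \<longleftrightarrow> s \<in> seqs X \<and> t \<in> seqs X \<and> hd s = hd t \<and> last s = last t \<and>
     p \<in> extensional {..<arity s} \<and> mono_on {..<arity s} p \<and>
     p ` {..<arity s} = {..<arity t} \<and>
     (\<forall>j < arity t. \<exists>i < arity s. p i = j \<and> (\<forall>k<arity s. p k = j \<longrightarrow> i \<le> k) \<and> t ! j = s ! i)"
  (is "_ \<longleftrightarrow> ?R")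
proof
  assume a: "(s,t,p) \<in> seq_mors X"
  then have im: "p ` {..<arity s} = {..<arity t}" by (simp add: seq_mors_def)
  have "\<exists>i < arity s. p i = j \<and> (\<forall>k<arity s. p k = j \<longrightarrow> i \<le> k) \<and> t ! j = s ! i" if j: "j < arity t" for j
  proof -
    have "t ! j = s ! Min {i. i < arity s \<and> p i = j}" using a j by (simp add: seq_mors_def)
    then show ?thesis using Min_fibre[OF im j] by blast
  qed
  moreover have "p \<in> extensional {..<arity s}" using a by (simp add: seq_mors_def PiE_def)
  ultimately show ?R using a by (simp add: seq_mors_def)
next
  assume r: ?R
  have "t ! j = s ! Min {i. i < arity s \<and> p i = j}" if "j < arity t" for j
  proof -
    obtain i where "i < arity s" "p i = j" "\<forall>k<arity s. p k = j \<longrightarrow> i \<le> k" "t ! j = s ! i" using r \<open>j < arity t\<close> by blast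
    then show ?thesis using Min_fibre_eq[of i "arity s" p j] by auto
  qed
  moreover have "p \<in> {..<arity s} \<rightarrow>\<^sub>E {..<arity t}" using r by (auto simp: PiE_def)
  ultimately show "(s,t,p) \<in> seq_mors X" using r by (simp add: seq_mors_def)
qed

lemma sm_lt: "(s,t,p) \<in> seq_mors X \<Longrightarrow> i < arity s \<Longrightarrow> p i < arity t"
  unfolding seq_mors_def by (simp add: PiE_def Pi_def)
lemma sm_mono: "(s,t,p) \<in> seq_mors X \<Longrightarrow> i \<le> j \<Longrightarrow> j < arity s \<Longrightarrow> p i \<le> p j"
  unfolding seq_mors_def by (simp add: monotone_on_def)
lemma sm_ex: "(s,t,p) \<in> seq_mors X \<Longrightarrow> j < arity t \<Longrightarrow> \<exists>i < arity s. p i = j \<and> (\<forall>k<arity s. p k = j \<longrightarrow> i \<le> k) \<and> t ! j = s ! i"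
  unfolding seq_mor_iff by simp

lemma seq_comp:
  assumes "(s,t,p) \<in> seq_mors X" "(t,r,q) \<in> seq_mors X"
  shows "(s,r,compose {..<arity s} q p) \<in> seq_mors X"
proof -
  note a = assms[unfolded seq_mor_iff]
  have pi: "\<And>i. i < arity s \<Longrightarrow> p i < arity t" using sm_lt[OF assms(1)] .
  have mp: "\<And>i j. i \<le> j \<Longrightarrow> j < arity s \<Longrightarrow> p i \<le> p j" using sm_mono[OF assms(1)] .
  have mq: "\<And>i j. i \<le> j \<Longrightarrow> j < arity t \<Longrightarrow> q i \<le> q j" using sm_mono[OF assms(2)] .
  have "compose {..<arity s} q p ` {..<arity s} = q ` p ` {..<arity s}"
    by (auto simp: compose_def image_image)
  then have im: "compose {..<arity s} q p ` {..<arity s} = {..<arity r}" using a by simp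
  have mono: "mono_on {..<arity s} (compose {..<arity s} q p)"
  proof (rule monotone_onI)
    fix x y assume "x \<in> {..<arity s}" "y \<in> {..<arity s}" "x \<le> y"
    then show "compose {..<arity s} q p x \<le> compose {..<arity s} q p y"
      using mq[OF mp[of x y] pi[of y]] by (simp add: compose_def)
  qed
  have "\<exists>i < arity s. compose {..<arity s} q p i = k \<and> (\<forall>l<arity s. compose {..<arity s} q p l = k \<longrightarrow> i \<le> l) \<and> r ! k = s ! i"
    if kk: "k < arity r" for k
  proof -
    obtain j where j: "j < arity t" "q j = k" "\<forall>l<arity t. q l = k \<longrightarrow> j \<le> l" "r ! k = t ! j" using sm_ex[OF assms(2) kk] by blast
    obtain i where i: "i < arity s" "p i = j" "\<forall>l<arity s. p l = j \<longrightarrow> i \<le> l" "t ! j = s ! i" using sm_ex[OF assms(1) j(1)] by blast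
    have "i \<le> l" if "l < arity s" "q (p l) = k" for l
    proof (rule ccontr)
      assume "\<not> i \<le> l"
      then have "p l \<le> j" using mp[of l i] i by auto
      moreover have "j \<le> p l" using j that pi by auto
      ultimately have "p l = j" by simp
      then show False using i(3)[rule_format, OF that(1)] \<open>\<not> i \<le> l\<close> by simp
    qed
    then show ?thesis using i j by (intro exI[of _ i]) (simp add: compose_def)
  qed
  moreover have "compose {..<arity s} q p \<in> extensional {..<arity s}" by (simp add: compose_def)
  ultimately show ?thesis using a im mono unfolding seq_mor_iff by simp
qed

lemma seq_id: "s \<in> seqs X \<Longrightarrow> (s,s,\<lambda>i\<in>{..<arity s}. i) \<in> seq_mors X"
  by (auto simp: seq_mor_iff monotone_on_def)

lemma seqsD: "s \<in> seqs X \<Longrightarrow> s \<noteq> [] \<and> tl s \<noteq> [] \<and> set s \<subseteq> X \<and> 0 < arity s"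
  unfolding seqs_def arity_def by (cases s) auto

lemma concat_seqs: assumes "s \<in> seqs X" "t \<in> seqs X"
  shows "concat_seq s t \<in> seqs X" "hd (concat_seq s t) = hd s" "last (concat_seq s t) = last t"
   "arity (concat_seq s t) = arity s + arity t"
  using assms seqsD[OF assms(1)] seqsD[OF assms(2)]
  unfolding seqs_def concat_seq_def arity_def by (auto simp: last_tl dest: list.set_sel(2))

lemma concat_nth: assumes "s \<in> seqs X" "t \<in> seqs X" "last s = hd t"
  shows "i < arity s \<Longrightarrow> concat_seq s t ! i = s ! i" "i \<le> arity t \<Longrightarrow> concat_seq s t ! (arity s + i) = t ! i"
proof -
  note d = seqsD[OF assms(1)] seqsD[OF assms(2)]
  show "i < arity s \<Longrightarrow> concat_seq s t ! i = s ! i" by (auto simp: concat_seq_def nth_append arity_def)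
  assume i: "i \<le> arity t"
  show "concat_seq s t ! (arity s + i) = t ! i"
  proof (cases i)
    case 0 then show ?thesis using d assms(3) by (simp add: concat_seq_def nth_append last_conv_nth hd_conv_nth arity_def)
  next
    case (Suc k)
    have "\<not> arity s + Suc k < length s" "arity s + Suc k - length s = k" using d by (auto simp: Suc_diff_Suc arity_def)
    then show ?thesis using Suc d i by (simp add: concat_seq_def nth_append nth_tl arity_def)
  qed
qed

lemma osum_aux:
  fixes n m n' m' :: nat and p p' :: "nat \<Rightarrow> nat" and S T :: "nat \<Rightarrow> 'x"
  defines "P \<equiv> (\<lambda>i \<in> {..<n + n'}. if i < n then p i else m + p' (i - n))"
  assumes pi: "\<And>i. i < n \<Longrightarrow> p i < m" and pi': "\<And>i. i < n' \<Longrightarrow> p' i < m'"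
   and mp: "\<And>i j. i \<le> j \<Longrightarrow> j < n \<Longrightarrow> p i \<le> p j" and mp': "\<And>i j. i \<le> j \<Longrightarrow> j < n' \<Longrightarrow> p' i \<le> p' j"
   and e: "\<And>j. j < m \<Longrightarrow> \<exists>i<n. p i = j \<and> (\<forall>k<n. p k = j \<longrightarrow> i \<le> k) \<and> T j = S i"
   and e': "\<And>j. j < m' \<Longrightarrow> \<exists>i<n'. p' i = j \<and> (\<forall>k<n'. p' k = j \<longrightarrow> i \<le> k) \<and> T (m + j) = S (n + i)"
  shows "mono_on {..<n+n'} P" "P ` {..<n+n'} = {..<m+m'}"
    "\<And>j. j < m + m' \<Longrightarrow> \<exists>i<n+n'. P i = j \<and> (\<forall>k<n+n'. P k = j \<longrightarrow> i \<le> k) \<and> T j = S i"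
proof -
  have P1: "P i = p i" if "i < n" for i using that by (simp add: P_def)
  have P2: "P i = m + p' (i - n)" if "\<not> i < n" "i < n + n'" for i using that by (simp add: P_def)
  show "mono_on {..<n + n'} P"
  proof (rule monotone_onI)
    fix i j assume ij: "i \<in> {..<n + n'}" "j \<in> {..<n + n'}" "i \<le> j"
    consider "j < n" | "i < n" "\<not> j < n" | "\<not> i < n" "\<not> j < n" by linarith
    then show "P i \<le> P j"
    proof cases
      case 1 then show ?thesis using ij mp[of i j] by (simp add: P1)
    next
      case 2 then show ?thesis using ij pi[of i] by (simp add: P1 P2)
    next
      case 3
      then have "i - n \<le> j - n" "j - n < n'" using ij by auto
      then show ?thesis using 3 ij mp'[of "i - n" "j - n"] by (simp add: P2)
    qed
  qed
  show ex: "\<exists>i<n+n'. P i = j \<and> (\<forall>k<n+n'. P k = j \<longrightarrow> i \<le> k) \<and> T j = S i" if j: "j < m + m'" for j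
  proof (cases "j < m")
    case True
    then obtain i where i: "i < n" "p i = j" "\<forall>k<n. p k = j \<longrightarrow> i \<le> k" "T j = S i" using e by blast
    have "i \<le> k" if "k < n + n'" "P k = j" for k
      using that i P1[of k] by (cases "k < n") auto
    then show ?thesis using i P1[of i] by (intro exI[of _ i]) simp
  next
    case False
    then have "j - m < m'" using j by auto
    from e'[OF this] obtain i where i: "i < n'" "p' i = j - m" "\<forall>k<n'. p' k = j - m \<longrightarrow> i \<le> k" "T (m + (j - m)) = S (n + i)" by blast
    have "n + i \<le> k" if k: "k < n + n'" "P k = j" for k
    proof -
      have nk: "\<not> k < n" using k False pi[of k] P1[of k] by auto
      then have "p' (k - n) = j - m" "k - n < n'" using k P2[of k] by auto
      then have "i \<le> k - n" using i(3) by blast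
      then show ?thesis using nk by simp
    qed
    then show ?thesis using i False P2[of "n + i"] by (intro exI[of _ "n + i"]) simp
  qed
  show "P ` {..<n + n'} = {..<m + m'}"
  proof
    show "P ` {..<n + n'} \<subseteq> {..<m + m'}"
    proof
      fix y assume "y \<in> P ` {..<n + n'}"
      then obtain i where i: "i < n + n'" "y = P i" by (rule imageE, unfold lessThan_iff)
      show "y \<in> {..<m + m'}"
      proof (cases "i < n")
        case True then show ?thesis using i pi[of i] P1[of i] by simp
      next
        case False then have "i - n < n'" using i by auto
        then show ?thesis using False i pi'[of "i - n"] P2[of i] by simp
      qed
    qed
    show "{..<m + m'} \<subseteq> P ` {..<n + n'}"
    proof
      fix j assume "j \<in> {..<m + m'}"
      then have "j < m + m'" by simp
      from ex[OF this] obtain i where "i < n + n'" "P i = j" by blast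
      then show "j \<in> P ` {..<n + n'}" by (intro image_eqI[of _ _ i]) simp_all
    qed
  qed
qed

lemma seq_sum:
  assumes "(s,t,p) \<in> seq_mors X" "(s',t',p') \<in> seq_mors X" "last s = hd s'"
  shows "ordinal_sum (s,t,p) (s',t',p') \<in> seq_mors X"
proof -
  note a = assms(1,2)[unfolded seq_mor_iff]
  have S: "s \<in> seqs X" "s' \<in> seqs X" "t \<in> seqs X" "t' \<in> seqs X" "last t = hd t'"
     "hd s = hd t" "last s' = last t'" using a assms(3) by auto
  note cs = concat_seqs[OF S(1,2)] and ct = concat_seqs[OF S(3,4)]
  note ns = concat_nth[OF S(1,2) assms(3)] and nt = concat_nth[OF S(3,4,5)]
  have e: "\<exists>i<arity s. p i = j \<and> (\<forall>k<arity s. p k = j \<longrightarrow> i \<le> k) \<and> concat_seq t t' ! j = concat_seq s s' ! i" if "j < arity t" for j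
    using sm_ex[OF assms(1) that] ns(1) nt(1)[OF that] by metis
  have e': "\<exists>i<arity s'. p' i = j \<and> (\<forall>k<arity s'. p' k = j \<longrightarrow> i \<le> k) \<and> concat_seq t t' ! (arity t + j) = concat_seq s s' ! (arity s + i)" if "j < arity t'" for j
    using sm_ex[OF assms(2) that] ns(2) nt(2)[of j] that by (metis less_imp_le)
  note o = osum_aux[where T = "\<lambda>i. concat_seq t t' ! i" and S = "\<lambda>i. concat_seq s s' ! i",
     OF sm_lt[OF assms(1)] sm_lt[OF assms(2)] sm_mono[OF assms(1)] sm_mono[OF assms(2)] e e']
  show ?thesis unfolding ordinal_sum.simps seq_mor_iff cs ct
    by (intro conjI allI impI S cs ct o restrict_extensional)
qed

lemma SX_simps [simp]: "Ob (SX X) = X" "Mor1 (SX X) = seqs X" "src (SX X) = hd" "trg (SX X) = last"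
  "Mor2 (SX X) = seq_mors X" "dom2 (SX X) (s,t,p) = s" "cod2 (SX X) (s,t,p) = t"
  "id2 (SX X) s = (s, s, (\<lambda>i \<in> {..<arity s}. i))"
  "vcomp (SX X) (t',r,q) (s,t,p) = (s, r, compose {..<arity s} q p)"
  "tens1 (SX X) = concat_seq" "tens2 (SX X) = ordinal_sum"
  by (simp_all add: SX_def)

lemma seq_morD: "(s,t,p) \<in> seq_mors X \<Longrightarrow> s \<in> seqs X \<and> t \<in> seqs X \<and> hd s = hd t \<and> last s = last t \<and> p \<in> {..<arity s} \<rightarrow>\<^sub>E {..<arity t}"
  by (simp add: seq_mors_def)

lemma Hom1_SX: "Hom1 (SX X) A B = {t \<in> seqs X. hd t = A \<and> last t = B}" by (simp add: Hom1_def)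
lemma Hom2_SX: "a \<in> Hom2 (SX X) s t \<longleftrightarrow> (\<exists>p. a = (s,t,p) \<and> (s,t,p) \<in> seq_mors X)"
  by (cases a) (auto simp: Hom2_def)

lemma category_SX: "category (Hom (SX X) A B)"
proof
  let ?C = "Hom (SX X) A B"
  have h: "f \<in> hom ?C x y \<longleftrightarrow> (\<exists>p. f = (x,y,p) \<and> (x,y,p) \<in> seq_mors X \<and> hd x = A \<and> last x = B)" for f x y
    by (cases f) (auto simp: hom_def Hom_def Hom1_SX dest: seq_morD)
  show "\<And>f. f \<in> Arr ?C \<Longrightarrow> Dom ?C f \<in> Obj ?C" by (auto simp: Hom_def)
  show "\<And>f. f \<in> Arr ?C \<Longrightarrow> Cod ?C f \<in> Obj ?C" by (auto simp: Hom_def Hom1_SX dest: seq_morD)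
  show "\<And>x. x \<in> Obj ?C \<Longrightarrow> Id ?C x \<in> hom ?C x x" by (simp add: h) (auto simp: Hom_def Hom1_SX seq_id)
  show "\<And>f x y g z. f \<in> hom ?C x y \<Longrightarrow> g \<in> hom ?C y z \<Longrightarrow> Comp ?C g f \<in> hom ?C x z"
    by (auto simp: h) (auto simp: Hom_def intro: seq_comp)
  have [simp]: "Comp ?C = vcomp (SX X)" "Id ?C = id2 (SX X)" by (simp_all add: Hom_def)
  show "Comp ?C f (Id ?C x) = f" if f: "f \<in> hom ?C x y" for f x y
  proof -
    obtain p where p: "f = (x,y,p)" "(x,y,p) \<in> seq_mors X" using f unfolding h by blast
    have "compose {..<arity x} p (\<lambda>i\<in>{..<arity x}. i) = p" using seq_morD[OF p(2)] by (intro compose_Id) (auto simp: PiE_def)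
    then show ?thesis using p(1) by simp
  qed
  show "Comp ?C (Id ?C y) f = f" if f: "f \<in> hom ?C x y" for f x y
  proof -
    obtain p where p: "f = (x,y,p)" "(x,y,p) \<in> seq_mors X" using f unfolding h by blast
    have "compose {..<arity x} (\<lambda>i\<in>{..<arity y}. i) p = p" using seq_morD[OF p(2)] by (intro Id_compose) (auto simp: PiE_def)
    then show ?thesis using p(1) by simp
  qed
  show "Comp ?C (Comp ?C k g) f = Comp ?C k (Comp ?C g f)"
    if f: "f \<in> hom ?C w x" and g: "g \<in> hom ?C x y" and k: "k \<in> hom ?C y z" for f g k w x y z
  proof -
    obtain p where p: "f = (w,x,p)" "(w,x,p) \<in> seq_mors X" using f unfolding h by blast
    obtain q where q: "g = (x,y,q)" "(x,y,q) \<in> seq_mors X" using g unfolding h by blast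
    obtain r where r: "k = (y,z,r)" using k unfolding h by blast
    have pp: "p \<in> {..<arity w} \<rightarrow> {..<arity x}" using seq_morD[OF p(2)] by (auto simp: PiE_def)
    show ?thesis using compose_assoc[OF pp, of r q] by (simp add: p(1) q(1) r)
  qed
qed

theorem semi_2_category_SX: "semi_2_category (SX X)"
proof (intro semi_2_category.intro pre_2_category.intro semi_2_category_axioms.intro)
  let ?S = "SX X"
  show "\<And>f. f \<in> Mor1 ?S \<Longrightarrow> src ?S f \<in> Ob ?S \<and> trg ?S f \<in> Ob ?S"
    using seqsD by fastforce
  show "a \<in> Mor2 ?S \<Longrightarrow> dom2 ?S a \<in> Mor1 ?S \<and> cod2 ?S a \<in> Mor1 ?S \<and>
        src ?S (dom2 ?S a) = src ?S (cod2 ?S a) \<and> trg ?S (dom2 ?S a) = trg ?S (cod2 ?S a)" for a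
    by (cases a) (auto dest: seq_morD)
  show "U \<in> Ob ?S \<Longrightarrow> V \<in> Ob ?S \<Longrightarrow> category (Hom ?S U V)" for U V by (rule category_SX)
  show "\<And>f U V g W. f \<in> Hom1 ?S U V \<Longrightarrow> g \<in> Hom1 ?S V W \<Longrightarrow> f \<otimes>\<^bsub>?S\<^esub> g \<in> Hom1 ?S U W"
    by (auto simp: Hom1_SX concat_seqs)
  show "\<lbrakk>f \<in> Hom1 ?S U V; g \<in> Hom1 ?S V W; a \<in> Hom2 ?S f f'; b \<in> Hom2 ?S g g'\<rbrakk>
        \<Longrightarrow> a \<star>\<^bsub>?S\<^esub> b \<in> Hom2 ?S (f \<otimes>\<^bsub>?S\<^esub> g) (f' \<otimes>\<^bsub>?S\<^esub> g')" for f g U V W a b f' g'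
    using seq_sum by (fastforce simp: Hom1_SX Hom2_SX)
  show "id2 ?S f \<star>\<^bsub>?S\<^esub> id2 ?S g = id2 ?S (f \<otimes>\<^bsub>?S\<^esub> g)"
    if "f \<in> Hom1 ?S U V" "g \<in> Hom1 ?S V W" for f g U V W
  proof -
    have c: "arity (concat_seq f g) = arity f + arity g" using that by (intro concat_seqs) (auto simp: Hom1_SX)
    have "(\<lambda>i\<in>{..<n + m}. if i < n then (\<lambda>i\<in>{..<n}. i) i else n + (\<lambda>i\<in>{..<m}. i) (i - n)) = (\<lambda>i\<in>{..<n+m}. i)" for n m :: nat
      by (rule ext) auto
    then show ?thesis unfolding SX_simps ordinal_sum.simps c by blast
  qed
  show "(a' \<bullet>\<^bsub>?S\<^esub> a) \<star>\<^bsub>?S\<^esub> (b' \<bullet>\<^bsub>?S\<^esub> b) = (a' \<star>\<^bsub>?S\<^esub> b') \<bullet>\<^bsub>?S\<^esub> (a \<star>\<^bsub>?S\<^esub> b)"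
    if h: "f \<in> Hom1 ?S U V" "g \<in> Hom1 ?S V W" "a \<in> Hom2 ?S f f'" "a' \<in> Hom2 ?S f' f''"
        "b \<in> Hom2 ?S g g'" "b' \<in> Hom2 ?S g' g''"
    for U V W f f' f'' g g' g'' a a' b b'
  proof -
    obtain p where p: "a = (f,f',p)" "(f,f',p) \<in> seq_mors X" using h(3) unfolding Hom2_SX by blast
    obtain p' where p': "a' = (f',f'',p')" "(f',f'',p') \<in> seq_mors X" using h(4) unfolding Hom2_SX by blast
    obtain q where q: "b = (g,g',q)" "(g,g',q) \<in> seq_mors X" using h(5) unfolding Hom2_SX by blast
    obtain q' where q': "b' = (g',g'',q')" "(g',g'',q') \<in> seq_mors X" using h(6) unfolding Hom2_SX by blast
    have c: "arity (concat_seq f g) = arity f + arity g" using h by (intro concat_seqs) (auto simp: Hom1_SX)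
    have gen: "(\<lambda>i\<in>{..<n+m}. if i < n then compose {..<n} p' p i else k + compose {..<m} q' q (i - n))
       = compose {..<n+m} (\<lambda>i\<in>{..<n'+m'}. if i < n' then p' i else k + q' (i - n'))
          (\<lambda>i\<in>{..<n+m}. if i < n then p i else n' + q (i - n))"
      if A: "\<And>i. i < n \<Longrightarrow> p i < n'" and B: "\<And>i. i < m \<Longrightarrow> q i < m'" for n m n' m' k :: nat
    proof (rule ext)
      fix x
      consider "x < n" | "\<not> x < n" "x < n + m" "x - n < m" | "\<not> x < n" "\<not> x < n + m" by linarith
      then show "(\<lambda>i\<in>{..<n+m}. if i < n then compose {..<n} p' p i else k + compose {..<m} q' q (i - n)) x
       = compose {..<n+m} (\<lambda>i\<in>{..<n'+m'}. if i < n' then p' i else k + q' (i - n'))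
          (\<lambda>i\<in>{..<n+m}. if i < n then p i else n' + q (i - n)) x"
        by cases (use A[of x] B[of "x - n"] in \<open>simp_all add: compose_def\<close>)
    qed
    show ?thesis using gen[where k="arity f''", OF sm_lt[OF p(2)] sm_lt[OF q(2)]]
      unfolding p(1) p'(1) q(1) q'(1) SX_simps ordinal_sum.simps c by simp
  qed
  show as: "(f \<otimes>\<^bsub>?S\<^esub> g) \<otimes>\<^bsub>?S\<^esub> h = f \<otimes>\<^bsub>?S\<^esub> (g \<otimes>\<^bsub>?S\<^esub> h)"
   if "f \<in> Hom1 ?S T U" "g \<in> Hom1 ?S U V" "h \<in> Hom1 ?S V W" for f g h T U V W
    using seqsD[of g X] that by (simp add: Hom1_SX concat_seq_def)
  show "(a \<star>\<^bsub>?S\<^esub> b) \<star>\<^bsub>?S\<^esub> c = a \<star>\<^bsub>?S\<^esub> (b \<star>\<^bsub>?S\<^esub> c)"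
    if h: "f \<in> Hom1 ?S T U" "g \<in> Hom1 ?S U V" "h \<in> Hom1 ?S V W"
        "a \<in> Hom2 ?S f f'" "b \<in> Hom2 ?S g g'" "c \<in> Hom2 ?S h h'" for f g h T U V W a b c f' g' h'
  proof -
    obtain p where p: "a = (f,f',p)" "(f,f',p) \<in> seq_mors X" using h(4) unfolding Hom2_SX by blast
    obtain q where q: "b = (g,g',q)" "(g,g',q) \<in> seq_mors X" using h(5) unfolding Hom2_SX by blast
    obtain r where r: "c = (h,h',r)" "(h,h',r) \<in> seq_mors X" using h(6) unfolding Hom2_SX by blast
    note m = seq_morD[OF p(2)] seq_morD[OF q(2)] seq_morD[OF r(2)]
    have c: "arity (concat_seq f g) = arity f + arity g" "arity (concat_seq g h) = arity g + arity h"
      "arity (concat_seq f' g') = arity f' + arity g'"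
      using m by (auto intro!: concat_seqs(4))
    have s: "concat_seq (concat_seq f g) h = concat_seq f (concat_seq g h)" "concat_seq (concat_seq f' g') h' = concat_seq f' (concat_seq g' h')"
      using m seqsD[of g X] seqsD[of g' X] by (auto simp: concat_seq_def)
    have gen: "(\<lambda>i\<in>{..<n+m+l}. if i < n + m then (\<lambda>i\<in>{..<n+m}. if i < n then p i else n' + q (i - n)) i else n' + m' + r (i - (n+m)))
       = (\<lambda>i\<in>{..<n+(m+l)}. if i < n then p i else n' + (\<lambda>i\<in>{..<m+l}. if i < m then q i else m' + r (i - m)) (i - n))"
       for n m l n' m' :: nat
      by (intro ext) (auto simp: add.assoc diff_diff_left)
    show ?thesis using gen[where n="arity f" and m="arity g" and l="arity h" and n'="arity f'" and m'="arity g'"]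
      unfolding p(1) q(1) r(1) SX_simps ordinal_sum.simps c s by blast
  qed
qed


section \<open>Lax morphisms and diagrams\<close>

record ('x, 's, 'm, 'u, 'f, 'a) laxmor =
  lob :: "'x \<Rightarrow> 'u"
  lmap1 :: "'s \<Rightarrow> 'f"
  lmap2 :: "'m \<Rightarrow> 'a"
  laxity :: "'s \<Rightarrow> 's \<Rightarrow> 'a"

locale lax_morphism =
  fixes S :: "('x, 's, 'm, 'y) semi2_scheme"
    and M :: "('u, 'f, 'a, 'z) bicat_scheme" (structure)
    and F :: "('x, 's, 'm, 'u, 'f, 'a) laxmor"
  assumes lob: "lob F \<in> Ob S \<rightarrow>\<^sub>E Ob M"
    and lmap: "\<lbrakk>A \<in> Ob S; B \<in> Ob S\<rbrakk> \<Longrightarrow>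
        is_functor (Hom S A B) (Hom M (lob F A) (lob F B)) \<lparr>omap = lmap1 F, amap = lmap2 F\<rparr>"
    and lmap1_ext: "lmap1 F \<in> extensional (Mor1 S)"
    and lmap2_ext: "lmap2 F \<in> extensional (Mor2 S)"
    and laxity: "\<lbrakk>s \<in> Hom1 S A B; t \<in> Hom1 S B C\<rbrakk> \<Longrightarrow>
        laxity F s t \<in> Hom2 M (lmap1 F s \<otimes> lmap1 F t) (lmap1 F (s \<otimes>\<^bsub>S\<^esub> t))"
    and laxity_ext: "case_prod (laxity F) \<in>
        extensional {(s, t). s \<in> Mor1 S \<and> t \<in> Mor1 S \<and> trg S s = src S t}"
    and laxity_natural: "\<lbrakk>s \<in> Hom1 S A B; t \<in> Hom1 S B C; u \<in> Hom2 S s s'; v \<in> Hom2 S t t'\<rbrakk> \<Longrightarrow>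
        laxity F s' t' \<bullet> (lmap2 F u \<star> lmap2 F v) = lmap2 F (u \<star>\<^bsub>S\<^esub> v) \<bullet> laxity F s t"
    and laxity_assoc: "\<lbrakk>r \<in> Hom1 S A B; s \<in> Hom1 S B C; t \<in> Hom1 S C D\<rbrakk> \<Longrightarrow>
        laxity F (r \<otimes>\<^bsub>S\<^esub> s) t \<bullet> (laxity F r s \<star> id2 M (lmap1 F t))
        = laxity F r (s \<otimes>\<^bsub>S\<^esub> t) \<bullet> (id2 M (lmap1 F r) \<star> laxity F s t)
            \<bullet> associator M (lmap1 F r) (lmap1 F s) (lmap1 F t)"

type_synonym ('x, 'u, 'f, 'a) diagram = "'x set \<times> ('x, 'x list, 'x seq_mor, 'u, 'f, 'a) laxmor"

definition SX_diagram :: "('u, 'f, 'a, 'z) bicat_scheme \<Rightarrow> ('x, 'u, 'f, 'a) diagram \<Rightarrow> bool" where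
  "SX_diagram M D \<longleftrightarrow> (case D of (X, F) \<Rightarrow> lax_morphism (two_op (SX X)) M F)"

definition strict_co_segal ::
  "('u, 'f, 'a, 'z) bicat_scheme \<Rightarrow> ('x, 'u, 'f, 'a) diagram \<Rightarrow> bool" where
  "strict_co_segal M D \<longleftrightarrow> SX_diagram M D \<and>
     (case D of (X, F) \<Rightarrow> \<forall>A \<in> X. \<forall>B \<in> X. \<forall>u \<in> Arr (Hom (SX X) A B).
        is_iso (Hom M (lob F A) (lob F B)) (lmap2 F u))"

text \<open>
  A map \<open>f : X \<rightarrow> Y\<close> acts on sequences entrywise. An arrow from \<open>(X, F)\<close> to \<open>(Y, G)\<close> consists of
  such an \<open>f\<close> lying over the identity of the objects of \<open>M\<close>, and natural transformations
  \<open>F\<^sub>A\<^sub>B \<Rightarrow> G\<^sub>f\<^sub>A\<^sub>,\<^sub>f\<^sub>B \<circ> f\<close> compatible with the laxity 2-morphisms.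
\<close>

fun map_seq_mor :: "('x \<Rightarrow> 'y) \<Rightarrow> 'x seq_mor \<Rightarrow> 'y seq_mor" where
  "map_seq_mor f (s, t, p) = (map f s, map f t, p)"

locale diagram_morphism =
  fixes M :: "('u, 'f, 'a, 'z) bicat_scheme" (structure)
    and h :: "(('x, 'u, 'f, 'a) diagram, 'x, 'x list, 'a) family_arrow"
    and X F Y G
  defines "X \<equiv> fst (mdom h)" and "F \<equiv> snd (mdom h)"
    and "Y \<equiv> fst (mcod h)" and "G \<equiv> snd (mcod h)"
  assumes mdom: "SX_diagram M (mdom h)"
    and mcod: "SX_diagram M (mcod h)"
    and mfun: "mfun h \<in> X \<rightarrow>\<^sub>E Y"
    and mfun_over: "A \<in> X \<Longrightarrow> lob G (mfun h A) = lob F A"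
    and mfam: "t \<in> seqs X \<Longrightarrow> mfam h t \<in> Hom2 M (lmap1 F t) (lmap1 G (map (mfun h) t))"
    and mfam_ext: "mfam h \<in> extensional (seqs X)"
    and mfam_natural: "u \<in> Hom2 (SX X) s t \<Longrightarrow>
        lmap2 G (map_seq_mor (mfun h) u) \<bullet> mfam h t = mfam h s \<bullet> lmap2 F u"
    and mfam_laxity: "\<lbrakk>s \<in> Hom1 (SX X) A B; t \<in> Hom1 (SX X) B C\<rbrakk> \<Longrightarrow>
        mfam h (concat_seq s t) \<bullet> laxity F s t
        = laxity G (map (mfun h) s) (map (mfun h) t) \<bullet> (mfam h s \<star> mfam h t)"

definition StrictCoSegal :: "('u, 'f, 'a, 'z) bicat_scheme \<Rightarrow>
  (('x, 'u, 'f, 'a) diagram,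
   (('x, 'u, 'f, 'a) diagram, 'x, 'x list, 'a) family_arrow) cat" where
  "StrictCoSegal M =
    \<lparr>Obj = {D. strict_co_segal M D},
     Arr = {h. diagram_morphism M h \<and> strict_co_segal M (mdom h) \<and> strict_co_segal M (mcod h)},
     Dom = mdom,
     Cod = mcod,
     Id = (\<lambda>(X, F). \<lparr>mdom = (X, F), mcod = (X, F), mfun = (\<lambda>A \<in> X. A),
                     mfam = (\<lambda>t \<in> seqs X. id2 M (lmap1 F t))\<rparr>),
     Comp = (\<lambda>k h. \<lparr>mdom = mdom h, mcod = mcod k,
                mfun = compose (fst (mdom h)) (mfun k) (mfun h),
                mfam = (\<lambda>t \<in> seqs (fst (mdom h)).
                  vcomp M (mfam k (map (mfun h) t)) (mfam h t))\<rparr>)\<rparr>"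

end

theory Submission
  imports Defs
begin

text \<open>
  The sequence \<open>(A, B)\<close> is terminal in the category of sequences from \<open>A\<close> to \<open>B\<close>, so a contravariant
  functor on it that inverts all arrows is constant up to the canonical isomorphisms
  \<open>F(A, B) \<rightarrow> F(t)\<close>. A semi-category therefore yields the constant diagram
  \<open>t \<mapsto> \<A>(hd t, last t)\<close> with its composition as laxity, and a strict Co-Segal diagram yields a
  semi-category by composing the laxity \<open>F(A, B) \<otimes> F(B, C) \<rightarrow> F(A, B, C)\<close> with the inverse of
  \<open>F(A, C) \<rightarrow> F(A, B, C)\<close>. One round trip is the identity, and on the other the canonical
  isomorphisms are the components of the counit.
\<close>

section \<open>Vertical composition and invertible 2-morphisms\<close>

text \<open>The laxity at two pairs takes values at a triple, so the composition of a Co-Segal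
  diagram can only be defined with an inverse. Its properties are nevertheless proved without
  handling that inverse: an equation between 2-morphisms into F(A, C) is composed with an invertible
  canonical map out of F(A, C), everything is rewritten in terms of laxity and functoriality, and
  the canonical map is then cancelled.

  The input is the naturality square of the laxity at two collapsing arrows. The ordinal sum of the
  collapses of s and t ends at the triple (hd s, hd t, last t), and collapsing that triple further
  must, by terminality, give the collapse of the concatenation. This square yields both
  associativity of the composition and compatibility of the counit with laxity. The associator in
  the coherence law of a diagram at three pairs is already the one in the associativity law of the
  semi-category, so no rebracketing has to be compared.

  Morphisms follow the same pattern: naturality at a collapsing arrow ties the component at t to the
  component at its two ends.\<close>

context pre_2_category
begin

text \<open>Turns the laws of the hom categories, which name the objects \<open>U\<close> and
  \<open>V\<close>, into laws about \<open>Hom2\<close>, where the 1-morphisms already determine the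
  objects.\<close>

lemma hom_Hom: "f \<in> Hom1 S U V \<Longrightarrow> hom (Hom S U V) f g = Hom2 S f g"
  by (auto simp: hom_def Hom_def Hom2_def)

lemma Hom2_Hom1:
  assumes "a \<in> Hom2 S f g" "f \<in> Hom1 S U V"
  shows "g \<in> Hom1 S U V"
  using assms dom2_cod2[of a] by (auto simp: Hom1_def Hom2_def)

lemma category_Hom_of:
  assumes "f \<in> Hom1 S U V"
  shows "category (Hom S U V)"
  using assms src_trg category_Hom by (auto simp: Hom1_def)

lemma Hom2_dom_Hom1: "a \<in> Hom2 S f g \<Longrightarrow> f \<in> Hom1 S (src S f) (trg S f)"
  using dom2_cod2 by (auto simp: Hom1_def Hom2_def)

lemma id2_Hom2:
  assumes "f \<in> Hom1 S U V"
  shows "id2 S f \<in> Hom2 S f f"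
  using category.Id_hom[OF category_Hom_of[OF assms], of f] assms hom_Hom[OF assms]
  by (simp add: Hom_def)

lemma vcomp_Hom2:
  assumes "a \<in> Hom2 S f g" "b \<in> Hom2 S g h"
  shows "b \<bullet> a \<in> Hom2 S f h"
proof -
  note f = Hom2_dom_Hom1[OF assms(1)]
  show ?thesis
    using category.Comp_hom[OF category_Hom_of[OF f], of a f g b h] assms
      hom_Hom[OF f] hom_Hom[OF Hom2_Hom1[OF assms(1) f]]
    by (simp add: Hom_def)
qed

lemma vcomp_id:
  assumes "a \<in> Hom2 S f g"
  shows "a \<bullet> id2 S f = a"
proof -
  note f = Hom2_dom_Hom1[OF assms]
  show ?thesis
    using category.Comp_Id[OF category_Hom_of[OF f], of a f g] assms hom_Hom[OF f]
    by (simp add: Hom_def)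
qed

lemma id_vcomp:
  assumes "a \<in> Hom2 S f g"
  shows "id2 S g \<bullet> a = a"
proof -
  note f = Hom2_dom_Hom1[OF assms]
  show ?thesis
    using category.Id_Comp[OF category_Hom_of[OF f], of a f g] assms hom_Hom[OF f]
    by (simp add: Hom_def)
qed

lemma vcomp_assoc:
  assumes "a \<in> Hom2 S f g" "b \<in> Hom2 S g h" "c \<in> Hom2 S h k"
  shows "c \<bullet> b \<bullet> a = c \<bullet> (b \<bullet> a)"
proof -
  note f = Hom2_dom_Hom1[OF assms(1)]
  note g = Hom2_Hom1[OF assms(1) f]
  note h = Hom2_Hom1[OF assms(2) g]
  show ?thesis
    using category.Comp_assoc[OF category_Hom_of[OF f], of a f g b h c k] assms
      hom_Hom[OF f] hom_Hom[OF g] hom_Hom[OF h]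
    by (simp add: Hom_def)
qed

text \<open>Exhibits the inverse explicitly and mentions no hom category. The ends are read off from
  \<open>a\<close>, so facts about the relation take the typing of \<open>a\<close> as a separate
  premise.\<close>

definition inverse2 :: "'a \<Rightarrow> 'a \<Rightarrow> bool" where
  "inverse2 a b \<longleftrightarrow> a \<in> Hom2 S (dom2 S a) (cod2 S a) \<and> b \<in> Hom2 S (cod2 S a) (dom2 S a) \<and>
     b \<bullet> a = id2 S (dom2 S a) \<and> a \<bullet> b = id2 S (cod2 S a)"

definition inv2 :: "'a \<Rightarrow> 'a" where
  "inv2 a = (SOME b. inverse2 a b)"

lemma inverse2D:
  assumes "inverse2 a b" "a \<in> Hom2 S f g"
  shows "b \<in> Hom2 S g f" "b \<bullet> a = id2 S f" "a \<bullet> b = id2 S g"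
  using assms by (auto simp: inverse2_def Hom2_def)

lemma inverse2I:
  assumes "a \<in> Hom2 S f g" "b \<in> Hom2 S g f" "b \<bullet> a = id2 S f" "a \<bullet> b = id2 S g"
  shows "inverse2 a b"
  using assms by (auto simp: inverse2_def Hom2_def)

lemma is_iso_iff:
  assumes "f \<in> Hom1 S U V" "a \<in> Hom2 S f g"
  shows "is_iso (Hom S U V) a \<longleftrightarrow> (\<exists>b. inverse2 a b)"
proof -
  have "a \<in> Arr (Hom S U V)" "Dom (Hom S U V) a = f" "Cod (Hom S U V) a = g"
    using assms by (auto simp: Hom_def Hom2_def)
  moreover have "dom2 S a = f" "cod2 S a = g" using assms(2) by (auto simp: Hom2_def)
  ultimately show ?thesis
    using hom_Hom[OF Hom2_Hom1[OF assms(2,1)]] assms(2)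
    by (auto simp: is_iso_def inverse2_def Hom_def)
qed

lemma is_iso_inv2:
  assumes "f \<in> Hom1 S U V" "a \<in> Hom2 S f g" "is_iso (Hom S U V) a"
  shows "inverse2 a (inv2 a)"
  using assms is_iso_iff unfolding inv2_def by (metis someI_ex)

lemma inverse2_cancel:
  assumes "inverse2 a c" "a \<in> Hom2 S g h" "x \<in> Hom2 S f g"
  shows "c \<bullet> (a \<bullet> x) = x"
  using vcomp_assoc[OF assms(3,2) inverse2D(1)[OF assms(1,2)]] inverse2D(2)[OF assms(1,2)]
    id_vcomp[OF assms(3)] by simp

lemma inverse2_cancel':
  assumes "inverse2 a c" "a \<in> Hom2 S g h" "x \<in> Hom2 S f h"
  shows "a \<bullet> (c \<bullet> x) = x"
  using vcomp_assoc[OF assms(3) inverse2D(1)[OF assms(1,2)] assms(2)] inverse2D(3)[OF assms(1,2)]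
    id_vcomp[OF assms(3)] by simp

text \<open>Two candidate 2-morphisms into F(A, C) may be compared after an invertible canonical
  map; this is the cancellation step of the proofs about \<open>segal_comp\<close>.\<close>

lemma inverse2_mono:
  assumes "inverse2 a c" "a \<in> Hom2 S g h" "x \<in> Hom2 S f g" "y \<in> Hom2 S f g" "a \<bullet> x = a \<bullet> y"
  shows "x = y"
  using assms inverse2_cancel by metis

text \<open>Reverses two opposite invertible sides of a commuting square. Applied to naturality and
  laxity squares, it shows that the pointwise inverse of a diagram morphism is again one.\<close>

lemma inverse2_square:
  assumes a: "inverse2 a a'" "a \<in> Hom2 S f g" and b: "inverse2 b b'" "b \<in> Hom2 S h k"
    and x: "x \<in> Hom2 S f h" and y: "y \<in> Hom2 S g k" and eq: "y \<bullet> a = b \<bullet> x"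
  shows "x \<bullet> a' = b' \<bullet> y"
proof -
  note a' = inverse2D[OF a] and b' = inverse2D[OF b]
  have "b \<bullet> (x \<bullet> a') = b \<bullet> x \<bullet> a'" using vcomp_assoc[OF a'(1) x b(2)] by simp
  also have "\<dots> = y \<bullet> (a \<bullet> a')" unfolding eq[symmetric] using vcomp_assoc[OF a'(1) a(2) y] .
  also have "\<dots> = y" using a'(3) vcomp_id[OF y] by simp
  also have "\<dots> = b \<bullet> (b' \<bullet> y)" using inverse2_cancel'[OF b y] by simp
  finally show ?thesis
    by (rule inverse2_mono[OF b vcomp_Hom2[OF a'(1) x] vcomp_Hom2[OF y b'(1)]])
qed

text \<open>Inverses are unique, so the arbitrary choice in \<open>inv2\<close> returns exactly the
  identity. This is why one round trip is an equality of records and not merely an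
  isomorphism.\<close>

lemma inv2_id:
  assumes "f \<in> Hom1 S U V"
  shows "inv2 (id2 S f) = id2 S f"
proof -
  note i = id2_Hom2[OF assms]
  have "inverse2 (id2 S f) (id2 S f)" using i by (auto intro: inverse2I vcomp_id)
  then have "inverse2 (id2 S f) (inv2 (id2 S f))" unfolding inv2_def by (rule someI)
  then show ?thesis using inverse2D[OF _ i] vcomp_id by metis
qed

lemma tens2_inverse2:
  assumes "f \<in> Hom1 S U V" "g \<in> Hom1 S V W" "a \<in> Hom2 S f f'" "b \<in> Hom2 S g g'"
    and "inverse2 a a'" "inverse2 b b'"
  shows "inverse2 (a \<star> b) (a' \<star> b')"
proof -
  note a' = inverse2D[OF assms(5,3)] and b' = inverse2D[OF assms(6,4)]
  note f' = Hom2_Hom1[OF assms(3,1)] and g' = Hom2_Hom1[OF assms(4,2)]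
  show ?thesis
  proof (rule inverse2I[OF tens2_Hom[OF assms(1-4)] tens2_Hom[OF f' g' a'(1) b'(1)]])
    show "a' \<star> b' \<bullet> (a \<star> b) = id2 S (f \<otimes> g)"
      using interchange[OF assms(1-3) a'(1) assms(4) b'(1)] a' b' tens2_id[OF assms(1,2)] by simp
    show "a \<star> b \<bullet> (a' \<star> b') = id2 S (f' \<otimes> g')"
      using interchange[OF f' g' a'(1) assms(3) b'(1) assms(4)] a' b' tens2_id[OF f' g'] by simp
  qed
qed

end

section \<open>The terminal sequences\<close>

text \<open>The unique arrow to the terminal sequence. The zero map is restricted because index maps
  in \<open>seq_mors\<close> are extensional.\<close>

definition collapse :: "'x list \<Rightarrow> 'x seq_mor" where
  "collapse t = (t, [hd t, last t], \<lambda>i \<in> {..<arity t}. 0)"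

lemma arity_pair [simp]: "arity [a, b] = 1"
  by (simp add: arity_def)

lemma seqs_pair [simp]: "[a, b] \<in> seqs X \<longleftrightarrow> a \<in> X \<and> b \<in> X"
  by (auto simp: seqs_def)

lemma seqs_triple [simp]: "[a, b, c] \<in> seqs X \<longleftrightarrow> a \<in> X \<and> b \<in> X \<and> c \<in> X"
  by (auto simp: seqs_def)

lemma concat_pair [simp]: "concat_seq s [a, b] = s @ [b]" "concat_seq [a, b] (b # t) = a # b # t"
  by (simp_all add: concat_seq_def)

lemma seqs_ends: "t \<in> seqs X \<Longrightarrow> hd t \<in> X \<and> last t \<in> X"
  using seqsD[of t X] hd_in_set last_in_set by blast

text \<open>The only fibre is all of \<open>{..<arity t}\<close>, with minimum 0, so the entry
  condition reduces to \<open>t ! 0 = hd t\<close>; surjectivity holds since the arity is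
  positive.\<close>

lemma collapse_Hom2:
  assumes "t \<in> seqs X"
  shows "collapse t \<in> Hom2 (SX X) t [hd t, last t]"
proof -
  have "0 < arity t" "t ! 0 = hd t" using seqsD[OF assms] by (auto simp: hd_conv_nth)
  then have "(t, [hd t, last t], \<lambda>i \<in> {..<arity t}. 0) \<in> seq_mors X"
    using assms seqs_ends[OF assms]
    by (auto simp: seq_mor_iff monotone_on_def intro!: exI[of _ 0] image_eqI[of _ _ 0])
  then show ?thesis by (simp add: Hom2_SX collapse_def)
qed

text \<open>Terminality: a pair has arity 1, so 0 is the only possible value of the index map, and
  the ends of the pair are forced by those of \<open>t\<close>.\<close>

lemma collapse_unique:
  assumes "u \<in> Hom2 (SX X) t [a, b]"
  shows "u = collapse t"
proof -
  obtain p where u: "u = (t, [a, b], p)" "(t, [a, b], p) \<in> seq_mors X"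
    using assms by (auto simp: Hom2_SX)
  note p = seq_morD[OF u(2)]
  have "p = (\<lambda>i \<in> {..<arity t}. 0)"
    by (rule extensionalityI[of _ "{..<arity t}"]) (use p in \<open>auto simp: PiE_def Pi_def\<close>)
  then show ?thesis using u p by (simp add: collapse_def)
qed

lemma SX_tens2_Hom2:
  assumes "u \<in> Hom2 (SX X) s s'" "v \<in> Hom2 (SX X) t t'" "last s = hd t"
  shows "ordinal_sum u v \<in> Hom2 (SX X) (concat_seq s t) (concat_seq s' t')"
  using assms seq_sum by (fastforce simp: Hom2_SX)

lemma SX_vcomp_Hom2:
  assumes "u \<in> Hom2 (SX X) s t" "v \<in> Hom2 (SX X) t r"
  shows "vcomp (SX X) v u \<in> Hom2 (SX X) s r"
  using assms seq_comp by (fastforce simp: Hom2_SX)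

lemma SX_id2_Hom2: "t \<in> seqs X \<Longrightarrow> id2 (SX X) t \<in> Hom2 (SX X) t t"
  using seq_id by (auto simp: Hom2_SX)

lemma SX_Hom2D:
  assumes "u \<in> Hom2 (SX X) s t"
  shows "s \<in> seqs X" "t \<in> seqs X" "hd t = hd s" "last t = last s" "u \<in> seq_mors X"
  using assms by (auto simp: Hom2_SX dest: seq_morD)

section \<open>Entrywise action of a map of object sets on sequences\<close>

lemma map_seqs: "t \<in> seqs X \<Longrightarrow> f \<in> X \<rightarrow> Y \<Longrightarrow> map f t \<in> seqs Y"
  by (auto simp: seqs_def)

lemma map_seq_ends: "t \<in> seqs X \<Longrightarrow> hd (map f t) = f (hd t) \<and> last (map f t) = f (last t)"
  using seqsD[of t X] by (simp add: hd_map last_map)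

lemma map_concat_seq: "map f (concat_seq s t) = concat_seq (map f s) (map f t)"
  by (simp add: concat_seq_def map_tl)

lemma arity_map [simp]: "arity (map f t) = arity t"
  by (simp add: arity_def)

text \<open>The index map is untouched, and the entry condition is an equation
  \<open>t ! j = s ! i\<close>, to both sides of which \<open>f\<close> can be applied.\<close>

lemma map_seq_mor_Hom2:
  assumes "u \<in> Hom2 (SX X) s t" "f \<in> X \<rightarrow> Y"
  shows "map_seq_mor f u \<in> Hom2 (SX Y) (map f s) (map f t)"
proof -
  obtain p where u: "u = (s, t, p)" "(s, t, p) \<in> seq_mors X" using assms by (auto simp: Hom2_SX)
  note p = u(2)[unfolded seq_mor_iff]
  have l: "\<And>i. i < arity s \<Longrightarrow> map f s ! i = f (s ! i)" "\<And>i. i < arity t \<Longrightarrow> map f t ! i = f (t ! i)"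
    by (auto simp: arity_def)
  have "\<exists>i<arity s. p i = j \<and> (\<forall>k<arity s. p k = j \<longrightarrow> i \<le> k) \<and> map f t ! j = map f s ! i"
    if "j < arity t" for j
    using sm_ex[OF u(2) that] l that by metis
  then have "(map f s, map f t, p) \<in> seq_mors Y"
    using p map_seqs[OF _ assms(2)] map_seq_ends[of s X f] map_seq_ends[of t X f]
    by (auto simp: seq_mor_iff)
  then show ?thesis using u by (simp add: Hom2_SX)
qed

lemma map_seq_mor_collapse: "t \<in> seqs X \<Longrightarrow> map_seq_mor f (collapse t) = collapse (map f t)"
  using map_seq_ends[of t X f] by (simp add: collapse_def)

section \<open>Diagrams of sequences\<close>

lemma is_functor_amap:
  "is_functor C D T \<Longrightarrow> f \<in> Arr C \<Longrightarrow> amap T f \<in> hom D (omap T (Dom C f)) (omap T (Cod C f))"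
  by (simp only: is_functor_def)

lemma is_functor_Comp:
  "\<lbrakk>is_functor C D T; f \<in> Arr C; g \<in> Arr C; Cod C f = Dom C g\<rbrakk>
    \<Longrightarrow> amap T (Comp C g f) = Comp D (amap T g) (amap T f)"
  by (simp only: is_functor_def)

lemma two_op_simps [simp]:
  "Ob (two_op S) = Ob S" "Mor1 (two_op S) = Mor1 S" "src (two_op S) = src S"
  "trg (two_op S) = trg S" "Mor2 (two_op S) = Mor2 S" "dom2 (two_op S) = cod2 S"
  "cod2 (two_op S) = dom2 S" "id2 (two_op S) = id2 S" "vcomp (two_op S) b a = vcomp S a b"
  "tens1 (two_op S) = tens1 S" "tens2 (two_op S) = tens2 S"
  by (simp_all add: two_op_def)

lemma Hom1_two_op [simp]: "Hom1 (two_op S) = Hom1 S"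
  by (auto simp: Hom1_def fun_eq_iff)

lemma Hom2_two_op [simp]: "Hom2 (two_op S) f g = Hom2 S g f"
  by (auto simp: Hom2_def)

text \<open>Joins a diagram with the axioms of its target so that the laws can be restated over
  \<open>SX X\<close> itself, with contravariance visible: \<open>lmap2 F u\<close> goes from the
  value at the target of \<open>u\<close> to the value at its source.\<close>

locale seq_diagram = bicategory M + lax_morphism "two_op (SX X)" M F
  for M :: "('u, 'f, 'a, 'z) bicat_scheme" (structure) and X :: "'x set"
    and F :: "('x, 'x list, 'x seq_mor, 'u, 'f, 'a) laxmor"
begin

lemma lmap_functor:
  assumes "t \<in> seqs X"
  shows "is_functor (Hom (two_op (SX X)) (hd t) (last t)) (Hom M (lob F (hd t)) (lob F (last t)))
    \<lparr>omap = lmap1 F, amap = lmap2 F\<rparr>"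
  using lmap seqs_ends[OF assms] by simp

lemma lmap1_Hom1: "t \<in> seqs X \<Longrightarrow> lmap1 F t \<in> Hom1 M (lob F (hd t)) (lob F (last t))"
  using lmap_functor[of t] by (auto simp: is_functor_def Hom_def Hom1_SX)

lemma lmap2_Hom2:
  assumes "u \<in> Hom2 (SX X) s t"
  shows "lmap2 F u \<in> Hom2 M (lmap1 F t) (lmap1 F s)"
proof -
  note u = SX_Hom2D[OF assms]
  have "u \<in> Arr (Hom (two_op (SX X)) (hd t) (last t))" "dom2 (SX X) u = s" "cod2 (SX X) u = t"
    using assms u by (auto simp: Hom_def Hom1_SX Hom2_def)
  then have "lmap2 F u \<in> hom (Hom M (lob F (hd t)) (lob F (last t))) (lmap1 F t) (lmap1 F s)"
    using is_functor_amap[OF lmap_functor[OF u(2)]] by (fastforce simp: Hom_def)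
  then show ?thesis using hom_Hom[OF lmap1_Hom1[OF u(2)]] by simp
qed

lemma lmap2_id: "t \<in> seqs X \<Longrightarrow> lmap2 F (id2 (SX X) t) = id2 M (lmap1 F t)"
  using lmap_functor[of t] by (auto simp: is_functor_def Hom_def Hom1_SX)

lemma lmap2_vcomp:
  assumes "u \<in> Hom2 (SX X) s t" "v \<in> Hom2 (SX X) t r"
  shows "lmap2 F (vcomp (SX X) v u) = lmap2 F u \<bullet> lmap2 F v"
proof -
  note u = SX_Hom2D[OF assms(1)] and v = SX_Hom2D[OF assms(2)]
  have "u \<in> Arr (Hom (two_op (SX X)) (hd t) (last t))" "v \<in> Arr (Hom (two_op (SX X)) (hd t) (last t))"
    "Cod (Hom (two_op (SX X)) (hd t) (last t)) v = Dom (Hom (two_op (SX X)) (hd t) (last t)) u"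
    using assms u v by (auto simp: Hom_def Hom1_SX Hom2_def)
  then show ?thesis
    using is_functor_Comp[OF lmap_functor[OF u(2)], of v u] by (simp add: Hom_def)
qed

lemma laxity_Hom2:
  assumes "s \<in> seqs X" "t \<in> seqs X" "last s = hd t"
  shows "laxity F s t \<in> Hom2 M (lmap1 F s \<otimes> lmap1 F t) (lmap1 F (concat_seq s t))"
  using laxity[of s "hd s" "last s" t "last t"] assms by (simp add: Hom1_SX)

lemma laxity_nat:
  assumes "u \<in> Hom2 (SX X) s s'" "v \<in> Hom2 (SX X) t t'" "last s = hd t"
  shows "laxity F s t \<bullet> (lmap2 F u \<star> lmap2 F v) = lmap2 F (ordinal_sum u v) \<bullet> laxity F s' t'"
  using laxity_natural[of s' "hd s'" "last s'" t' "last t'" u s v t] assms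
    SX_Hom2D[OF assms(1)] SX_Hom2D[OF assms(2)] by (simp add: Hom1_SX)

lemma laxity_assoc_seqs:
  assumes "r \<in> seqs X" "s \<in> seqs X" "t \<in> seqs X" "last r = hd s" "last s = hd t"
  shows "laxity F (concat_seq r s) t \<bullet> (laxity F r s \<star> id2 M (lmap1 F t))
        = laxity F r (concat_seq s t) \<bullet> (id2 M (lmap1 F r) \<star> laxity F s t)
            \<bullet> associator M (lmap1 F r) (lmap1 F s) (lmap1 F t)"
  using laxity_assoc[of r "hd r" "hd s" s "hd t" t "last t"] assms by (simp add: Hom1_SX)

end

text \<open>The converse of the restatements above, so that \<open>two_op\<close> and the functor
  records are unfolded only once. The bicategory axioms identify arrows of the hom categories with
  \<open>Hom2\<close>.\<close>

lemma SX_diagramI: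
  assumes "bicategory M"
    and "lob F \<in> X \<rightarrow>\<^sub>E Ob M" "lmap1 F \<in> extensional (seqs X)" "lmap2 F \<in> extensional (seq_mors X)"
    and "case_prod (laxity F) \<in> extensional {(s, t). s \<in> seqs X \<and> t \<in> seqs X \<and> last s = hd t}"
    and l1: "\<And>t. t \<in> seqs X \<Longrightarrow> lmap1 F t \<in> Hom1 M (lob F (hd t)) (lob F (last t))"
    and l2: "\<And>u s t. u \<in> Hom2 (SX X) s t \<Longrightarrow> lmap2 F u \<in> Hom2 M (lmap1 F t) (lmap1 F s)"
    and id: "\<And>t. t \<in> seqs X \<Longrightarrow> lmap2 F (id2 (SX X) t) = id2 M (lmap1 F t)"
    and comp: "\<And>u v r s t. \<lbrakk>u \<in> Hom2 (SX X) s t; v \<in> Hom2 (SX X) t r\<rbrakk>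
      \<Longrightarrow> lmap2 F (vcomp (SX X) v u) = vcomp M (lmap2 F u) (lmap2 F v)"
    and lax: "\<And>s t. \<lbrakk>s \<in> seqs X; t \<in> seqs X; last s = hd t\<rbrakk> \<Longrightarrow>
      laxity F s t \<in> Hom2 M (tens1 M (lmap1 F s) (lmap1 F t)) (lmap1 F (concat_seq s t))"
    and nat: "\<And>u v s s' t t'. \<lbrakk>u \<in> Hom2 (SX X) s s'; v \<in> Hom2 (SX X) t t'; last s = hd t\<rbrakk> \<Longrightarrow>
      vcomp M (laxity F s t) (tens2 M (lmap2 F u) (lmap2 F v))
        = vcomp M (lmap2 F (ordinal_sum u v)) (laxity F s' t')"
    and assoc: "\<And>r s t. \<lbrakk>r \<in> seqs X; s \<in> seqs X; t \<in> seqs X; last r = hd s; last s = hd t\<rbrakk> \<Longrightarrow>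
      vcomp M (laxity F (concat_seq r s) t) (tens2 M (laxity F r s) (id2 M (lmap1 F t)))
        = vcomp M (vcomp M (laxity F r (concat_seq s t)) (tens2 M (id2 M (lmap1 F r)) (laxity F s t)))
            (associator M (lmap1 F r) (lmap1 F s) (lmap1 F t))"
  shows "SX_diagram M (X, F)"
proof -
  interpret bicategory M by fact
  have "is_functor (Hom (two_op (SX X)) A B) (Hom M (lob F A) (lob F B)) \<lparr>omap = lmap1 F, amap = lmap2 F\<rparr>"
    (is "is_functor ?S ?M ?F") if "A \<in> X" "B \<in> X" for A B
    unfolding is_functor_def
  proof (intro conjI ballI impI)
    show "omap ?F x \<in> Obj ?M" if "x \<in> Obj ?S" for x
      using that l1[of x] by (auto simp: Hom_def Hom1_SX)
    show "amap ?F u \<in> hom ?M (omap ?F (Dom ?S u)) (omap ?F (Cod ?S u))" if u: "u \<in> Arr ?S" for u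
    proof -
      have "u \<in> Hom2 (SX X) (dom2 (SX X) u) (cod2 (SX X) u)" "cod2 (SX X) u \<in> Hom1 (SX X) A B"
        using u by (auto simp: Hom_def Hom2_def)
      then show ?thesis
        using l2 l1[of "cod2 (SX X) u"] hom_Hom[of "lmap1 F (cod2 (SX X) u)"]
        by (auto simp: Hom_def Hom1_SX)
    qed
    show "amap ?F (Id ?S x) = Id ?M (omap ?F x)" if "x \<in> Obj ?S" for x
      using that id by (auto simp: Hom_def Hom1_SX simp del: SX_simps(8))
    show "amap ?F (Comp ?S v u) = Comp ?M (amap ?F v) (amap ?F u)"
      if "u \<in> Arr ?S" "v \<in> Arr ?S" "Cod ?S u = Dom ?S v" for u v
      using comp[of v "dom2 (SX X) v" "cod2 (SX X) v" u "cod2 (SX X) u"] that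
      by (auto simp: Hom_def Hom2_def)
  qed
  moreover have "\<And>s t A B C. \<lbrakk>s \<in> Hom1 (SX X) A B; t \<in> Hom1 (SX X) B C\<rbrakk> \<Longrightarrow> s \<in> seqs X \<and> t \<in> seqs X \<and> last s = hd t"
    by (auto simp: Hom1_SX)
  \<comment> \<open>The lax morphism axiom supplies composability of the targets in
    \<open>SX X\<close>, whereas \<open>nat\<close> asks for it at the sources; arrows preserve both
    ends.\<close>
  moreover have "last s' = hd t'" if "s \<in> Hom1 (SX X) A B" "t \<in> Hom1 (SX X) B C"
      "u \<in> Hom2 (SX X) s' s" "v \<in> Hom2 (SX X) t' t" for s s' t t' A B C u v
    using that SX_Hom2D[OF that(3)] SX_Hom2D[OF that(4)] by (auto simp: Hom1_SX)
  ultimately show ?thesis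
    unfolding SX_diagram_def prod.case lax_morphism_def
    using assms(2-5) lax nat assoc by (auto simp del: SX_simps(8,9))
qed

section \<open>Canonical maps and composition of a strict Co-Segal diagram\<close>

locale co_segal_diagram = seq_diagram M X F
  for M :: "('u, 'f, 'a, 'z) bicat_scheme" (structure) and X :: "'x set"
    and F :: "('x, 'x list, 'x seq_mor, 'u, 'f, 'a) laxmor" +
  assumes lmap2_iso: "\<lbrakk>A \<in> X; B \<in> X; u \<in> Arr (Hom (SX X) A B)\<rbrakk> \<Longrightarrow>
    is_iso (Hom M (lob F A) (lob F B)) (lmap2 F u)"
begin

lemma lmap2_inverse2:
  assumes "u \<in> Hom2 (SX X) s t"
  shows "inverse2 (lmap2 F u) (inv2 (lmap2 F u))"
proof -
  note u = SX_Hom2D[OF assms]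
  have "is_iso (Hom M (lob F (hd s)) (lob F (last s))) (lmap2 F u)"
    by (rule lmap2_iso) (use seqs_ends[OF u(1)] u(1,5) assms in \<open>auto simp: Hom_def Hom1_SX Hom2_def\<close>)
  then show ?thesis
    using is_iso_inv2[OF _ lmap2_Hom2[OF assms]] lmap1_Hom1[OF u(2)] u by simp
qed

lemma collapse_inverse2: "t \<in> seqs X \<Longrightarrow> inverse2 (lmap2 F (collapse t)) (inv2 (lmap2 F (collapse t)))"
  by (rule lmap2_inverse2[OF collapse_Hom2])

lemma lmap2_collapse_Hom2:
  "t \<in> seqs X \<Longrightarrow> lmap2 F (collapse t) \<in> Hom2 M (lmap1 F [hd t, last t]) (lmap1 F t)"
  by (rule lmap2_Hom2[OF collapse_Hom2])

lemma inv2_collapse_Hom2: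
  "t \<in> seqs X \<Longrightarrow> inv2 (lmap2 F (collapse t)) \<in> Hom2 M (lmap1 F t) (lmap1 F [hd t, last t])"
  using inverse2D(1)[OF collapse_inverse2 lmap2_collapse_Hom2] by blast

lemma lmap1_pair: "A \<in> X \<Longrightarrow> B \<in> X \<Longrightarrow> lmap1 F [A, B] \<in> Hom1 M (lob F A) (lob F B)"
  using lmap1_Hom1[of "[A, B]"] by simp

text \<open>By terminality \<open>u\<close> followed by \<open>collapse t\<close> is
  \<open>collapse s\<close>; applying the contravariant \<open>F\<close> gives what becomes
  naturality of the counit in the sequence.\<close>

lemma lmap2_collapse_vcomp:
  assumes "u \<in> Hom2 (SX X) s t"
  shows "lmap2 F u \<bullet> lmap2 F (collapse t) = lmap2 F (collapse s)"
proof -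
  note u = SX_Hom2D[OF assms]
  have c: "collapse t \<in> Hom2 (SX X) t [hd s, last s]" using collapse_Hom2[OF u(2)] u by simp
  show ?thesis
    using lmap2_vcomp[OF assms c] collapse_unique[OF SX_vcomp_Hom2[OF assms c]] by simp
qed

definition segal_comp :: "'x \<Rightarrow> 'x \<Rightarrow> 'x \<Rightarrow> 'a" where
  "segal_comp A B C = inv2 (lmap2 F (collapse [A, B, C])) \<bullet> laxity F [A, B] [B, C]"

lemma laxity_pair:
  assumes "A \<in> X" "B \<in> X" "C \<in> X"
  shows "laxity F [A, B] [B, C] \<in> Hom2 M (lmap1 F [A, B] \<otimes> lmap1 F [B, C]) (lmap1 F [A, B, C])"
  using laxity_Hom2[of "[A, B]" "[B, C]"] assms by simp

lemma segal_comp_Hom2: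
  assumes "A \<in> X" "B \<in> X" "C \<in> X"
  shows "segal_comp A B C \<in> Hom2 M (lmap1 F [A, B] \<otimes> lmap1 F [B, C]) (lmap1 F [A, C])"
  unfolding segal_comp_def
  using vcomp_Hom2[OF laxity_pair[OF assms]] inv2_collapse_Hom2[of "[A, B, C]"] assms by simp

text \<open>An inverse-free characterization of the composition, through which it is handled from
  here on; only the constant diagram goes back to the definition.\<close>

lemma segal_comp_collapse:
  assumes "A \<in> X" "B \<in> X" "C \<in> X"
  shows "lmap2 F (collapse [A, B, C]) \<bullet> segal_comp A B C = laxity F [A, B] [B, C]"
  unfolding segal_comp_def
  using inverse2_cancel'[OF collapse_inverse2 lmap2_collapse_Hom2 laxity_pair[OF assms]] assms by simp

text \<open>Naturality of the laxity at both collapses leads to the triple of ends, where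
  \<open>segal_comp_collapse\<close> splits the laxity at pairs through a canonical map. Terminality
  merges that map with the image of the ordinal sum into the canonical map of the
  concatenation.\<close>

lemma laxity_collapse:
  assumes s: "s \<in> seqs X" and t: "t \<in> seqs X" and e: "last s = hd t"
  shows "laxity F s t \<bullet> (lmap2 F (collapse s) \<star> lmap2 F (collapse t))
    = lmap2 F (collapse (concat_seq s t)) \<bullet> segal_comp (hd s) (hd t) (last t)"
proof -
  note X = seqs_ends[OF s] seqs_ends[OF t]
  have cs: "collapse s \<in> Hom2 (SX X) s [hd s, hd t]" using collapse_Hom2[OF s] e by simp
  note o = SX_tens2_Hom2[OF cs collapse_Hom2[OF t] e]
  have o': "ordinal_sum (collapse s) (collapse t) \<in> Hom2 (SX X) (concat_seq s t) [hd s, hd t, last t]"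
    using o by simp
  have c: "lmap2 F (collapse [hd s, hd t, last t]) \<in> Hom2 M (lmap1 F [hd s, last t]) (lmap1 F [hd s, hd t, last t])"
    using lmap2_collapse_Hom2[of "[hd s, hd t, last t]"] X by simp
  have "laxity F s t \<bullet> (lmap2 F (collapse s) \<star> lmap2 F (collapse t))
      = lmap2 F (ordinal_sum (collapse s) (collapse t)) \<bullet> laxity F [hd s, hd t] [hd t, last t]"
    using laxity_nat[OF cs collapse_Hom2[OF t] e] .
  also have "\<dots> = lmap2 F (ordinal_sum (collapse s) (collapse t)) \<bullet>
      (lmap2 F (collapse [hd s, hd t, last t]) \<bullet> segal_comp (hd s) (hd t) (last t))"
    using segal_comp_collapse X by simp
  also have "\<dots> = lmap2 F (collapse (concat_seq s t)) \<bullet> segal_comp (hd s) (hd t) (last t)"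
    using vcomp_assoc[OF segal_comp_Hom2 c lmap2_Hom2[OF o']] lmap2_collapse_vcomp[OF o'] X by simp
  finally show ?thesis .
qed

text \<open>Compare both sides after the monomorphism \<open>F(A, D) \<rightarrow> F(A, B, C, D)\<close>.\<close>

lemma segal_comp_assoc:
  assumes X: "A \<in> X" "B \<in> X" "C \<in> X" "D \<in> X"
  shows "segal_comp A C D \<bullet> (segal_comp A B C \<star> id2 M (lmap1 F [C, D]))
    = segal_comp A B D \<bullet> (id2 M (lmap1 F [A, B]) \<star> segal_comp B C D)
        \<bullet> associator M (lmap1 F [A, B]) (lmap1 F [B, C]) (lmap1 F [C, D])"
    (is "?l = ?m \<bullet> ?\<alpha>")
proof -
  let ?c = "lmap2 F (collapse [A, B, C, D])"
  have t: "[A, B, C, D] \<in> seqs X" using X by (auto simp: seqs_def)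
  note c = lmap2_collapse_Hom2[OF t, simplified]
  note l = lmap1_pair[OF X(1,2)] lmap1_pair[OF X(2,3)] lmap1_pair[OF X(3,4)]
    lmap1_pair[OF X(1,3)] lmap1_pair[OF X(2,4)]
  note l3 = tens1_Hom[OF l(1,2)] tens1_Hom[OF l(2,3)]
  note g = segal_comp_Hom2
  \<comment> \<open>At a pair the collapse is the identity, so \<open>laxity_collapse\<close>
    applied to a triple and a pair has an identity as one tensor factor, as in the associativity
    law.\<close>
  have id: "lmap2 F (collapse [P, Q]) = id2 M (lmap1 F [P, Q])" if "P \<in> X" "Q \<in> X" for P Q
    using lmap2_id[of "[P, Q]"] collapse_unique[OF SX_id2_Hom2[of "[P, Q]" X]] that by simp
  have \<alpha>: "?\<alpha> \<in> Hom2 M (lmap1 F [A, B] \<otimes> lmap1 F [B, C] \<otimes> lmap1 F [C, D])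
      (lmap1 F [A, B] \<otimes> (lmap1 F [B, C] \<otimes> lmap1 F [C, D]))"
    using associator_Hom[OF l(1-3)] by simp
  note i = id2_Hom2[OF l(1)] id2_Hom2[OF l(3)]
  note gl = tens2_Hom[OF l3(1) l(3) g[OF X(1-3)] i(2)] and gr = tens2_Hom[OF l(1) l3(2) i(1) g[OF X(2-4)]]
  note cABC = lmap2_collapse_Hom2[of "[A, B, C]", simplified, OF conjI[OF X(1) conjI[OF X(2,3)]]]
  note cBCD = lmap2_collapse_Hom2[of "[B, C, D]", simplified, OF conjI[OF X(2) conjI[OF X(3,4)]]]
  have lax1: "laxity F [A, B, C] [C, D] \<in> Hom2 M (lmap1 F [A, B, C] \<otimes> lmap1 F [C, D]) (lmap1 F [A, B, C, D])"
    using laxity_Hom2[of "[A, B, C]" "[C, D]"] X by simp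
  have lax2: "laxity F [A, B] [B, C, D] \<in> Hom2 M (lmap1 F [A, B] \<otimes> lmap1 F [B, C, D]) (lmap1 F [A, B, C, D])"
    using laxity_Hom2[of "[A, B]" "[B, C, D]"] X by simp
  \<comment> \<open>\<open>laxity_collapse\<close> moves the canonical map inside the tensor as the
    one at the triple (A, B, C); interchange brings it next to \<open>segal_comp A B C\<close>,
    which it turns into laxity.\<close>
  have L: "?c \<bullet> ?l = laxity F [A, B, C] [C, D] \<bullet> (laxity F [A, B] [B, C] \<star> id2 M (lmap1 F [C, D]))"
  proof -
    have "?c \<bullet> ?l = ?c \<bullet> segal_comp A C D \<bullet> (segal_comp A B C \<star> id2 M (lmap1 F [C, D]))"
      using vcomp_assoc[OF gl g[OF X(1,3,4)] c] by simp
    also have "\<dots> = laxity F [A, B, C] [C, D] \<bullet> (lmap2 F (collapse [A, B, C]) \<star> id2 M (lmap1 F [C, D]))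
        \<bullet> (segal_comp A B C \<star> id2 M (lmap1 F [C, D]))"
      using laxity_collapse[of "[A, B, C]" "[C, D]"] id X by simp
    also have "\<dots> = laxity F [A, B, C] [C, D] \<bullet> ((lmap2 F (collapse [A, B, C]) \<star> id2 M (lmap1 F [C, D]))
        \<bullet> (segal_comp A B C \<star> id2 M (lmap1 F [C, D])))"
      using vcomp_assoc[OF gl tens2_Hom[OF l(4,3) cABC i(2)] lax1] by simp
    also have "\<dots> = laxity F [A, B, C] [C, D] \<bullet> (laxity F [A, B] [B, C] \<star> id2 M (lmap1 F [C, D]))"
      using interchange[OF l3(1) l(3) g[OF X(1-3)] cABC i(2) i(2)] vcomp_id[OF i(2)]
        segal_comp_collapse X by simp
    finally show ?thesis .
  qed
  have R: "?c \<bullet> ?m = laxity F [A, B] [B, C, D] \<bullet> (id2 M (lmap1 F [A, B]) \<star> laxity F [B, C] [C, D])"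
  proof -
    have "?c \<bullet> ?m = ?c \<bullet> segal_comp A B D \<bullet> (id2 M (lmap1 F [A, B]) \<star> segal_comp B C D)"
      using vcomp_assoc[OF gr g[OF X(1,2,4)] c] by simp
    also have "\<dots> = laxity F [A, B] [B, C, D] \<bullet> (id2 M (lmap1 F [A, B]) \<star> lmap2 F (collapse [B, C, D]))
        \<bullet> (id2 M (lmap1 F [A, B]) \<star> segal_comp B C D)"
      using laxity_collapse[of "[A, B]" "[B, C, D]"] id X by simp
    also have "\<dots> = laxity F [A, B] [B, C, D] \<bullet> ((id2 M (lmap1 F [A, B]) \<star> lmap2 F (collapse [B, C, D]))
        \<bullet> (id2 M (lmap1 F [A, B]) \<star> segal_comp B C D))"
      using vcomp_assoc[OF gr tens2_Hom[OF l(1,5) i(1) cBCD] lax2] by simp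
    also have "\<dots> = laxity F [A, B] [B, C, D] \<bullet> (id2 M (lmap1 F [A, B]) \<star> laxity F [B, C] [C, D])"
      using interchange[OF l(1) l3(2) i(1) i(1) g[OF X(2-4)] cBCD] vcomp_id[OF i(1)]
        segal_comp_collapse X by simp
    finally show ?thesis .
  qed
  note m = vcomp_Hom2[OF gr g[OF X(1,2,4)]]
  \<comment> \<open>Both sides are now iterated laxities at three pairs, so the coherence law of the
    diagram equates them and contributes the associator.\<close>
  have "?c \<bullet> ?l = ?c \<bullet> (?m \<bullet> ?\<alpha>)"
    using L R vcomp_assoc[OF \<alpha> m c] laxity_assoc_seqs[of "[A, B]" "[B, C]" "[C, D]"] X by simp
  then show ?thesis
    by (rule inverse2_mono[OF collapse_inverse2[OF t] c vcomp_Hom2[OF gl g[OF X(1,3,4)]] vcomp_Hom2[OF \<alpha> m]])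
qed

end

section \<open>The categories of semi-categories and of Co-Segal diagrams\<close>

lemma co_segal_diagram_iff:
  assumes "bicategory M"
  shows "strict_co_segal M (X, F) \<longleftrightarrow> co_segal_diagram M X F"
  using assms unfolding strict_co_segal_def SX_diagram_def co_segal_diagram_def seq_diagram_def
    co_segal_diagram_axioms_def by auto

lemma seq_diagram_iff:
  assumes "bicategory M"
  shows "SX_diagram M (X, F) \<longleftrightarrow> seq_diagram M X F"
  using assms unfolding SX_diagram_def seq_diagram_def by auto

text \<open>Names the components that the locale reaches only through \<open>fst\<close> and
  \<open>snd\<close>. The order of the conjuncts fixes the case numbers in later proofs: 7 is
  naturality and 8 is compatibility with laxity.\<close>

lemma diagram_morphism_iff:
  assumes "mdom h = (X, F)" "mcod h = (Y, G)"
  shows "diagram_morphism M h \<longleftrightarrow> SX_diagram M (X, F) \<and> SX_diagram M (Y, G) \<and>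
    mfun h \<in> X \<rightarrow>\<^sub>E Y \<and> (\<forall>A \<in> X. lob G (mfun h A) = lob F A) \<and>
    (\<forall>t \<in> seqs X. mfam h t \<in> Hom2 M (lmap1 F t) (lmap1 G (map (mfun h) t))) \<and>
    mfam h \<in> extensional (seqs X) \<and>
    (\<forall>u s t. u \<in> Hom2 (SX X) s t \<longrightarrow>
      vcomp M (lmap2 G (map_seq_mor (mfun h) u)) (mfam h t) = vcomp M (mfam h s) (lmap2 F u)) \<and>
    (\<forall>s \<in> seqs X. \<forall>t \<in> seqs X. last s = hd t \<longrightarrow>
      vcomp M (mfam h (concat_seq s t)) (laxity F s t)
        = vcomp M (laxity G (map (mfun h) s) (map (mfun h) t)) (tens2 M (mfam h s) (mfam h t)))"
  unfolding diagram_morphism_def assms fst_conv snd_conv Hom1_SX by blast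

lemma SemiCat_simps [simp]:
  "Obj (SemiCat M) = {A. semi_category M A}" "Arr (SemiCat M) = {h. semi_functor M h}"
  "Dom (SemiCat M) = mdom" "Cod (SemiCat M) = mcod"
  "mdom (Id (SemiCat M) A) = A" "mcod (Id (SemiCat M) A) = A"
  "mfun (Id (SemiCat M) A) = (\<lambda>a \<in> sset A. a)"
  "mfam (Id (SemiCat M) A) = (\<lambda>(a, b) \<in> sset A \<times> sset A. id2 M (shom A a b))"
  "mdom (Comp (SemiCat M) k h) = mdom h" "mcod (Comp (SemiCat M) k h) = mcod k"
  "mfun (Comp (SemiCat M) k h) = compose (sset (mdom h)) (mfun k) (mfun h)"
  "mfam (Comp (SemiCat M) k h) = (\<lambda>(a, b) \<in> sset (mdom h) \<times> sset (mdom h).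
    vcomp M (mfam k (mfun h a, mfun h b)) (mfam h (a, b)))"
  by (simp_all add: SemiCat_def)

lemma StrictCoSegal_simps [simp]:
  "Obj (StrictCoSegal M) = {D. strict_co_segal M D}"
  "Arr (StrictCoSegal M) =
    {h. diagram_morphism M h \<and> strict_co_segal M (mdom h) \<and> strict_co_segal M (mcod h)}"
  "Dom (StrictCoSegal M) = mdom" "Cod (StrictCoSegal M) = mcod"
  "mdom (Id (StrictCoSegal M) D) = D" "mcod (Id (StrictCoSegal M) D) = D"
  "mfun (Id (StrictCoSegal M) D) = (\<lambda>a \<in> fst D. a)"
  "mfam (Id (StrictCoSegal M) D) = (\<lambda>t \<in> seqs (fst D). id2 M (lmap1 (snd D) t))"
  "mdom (Comp (StrictCoSegal M) k h) = mdom h" "mcod (Comp (StrictCoSegal M) k h) = mcod k"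
  "mfun (Comp (StrictCoSegal M) k h) = compose (fst (mdom h)) (mfun k) (mfun h)"
  "mfam (Comp (StrictCoSegal M) k h) = (\<lambda>t \<in> seqs (fst (mdom h)).
    vcomp M (mfam k (map (mfun h) t)) (mfam h t))"
  by (simp_all add: StrictCoSegal_def split: prod.split)

lemma map_restrict_id: "t \<in> seqs X \<Longrightarrow> map (\<lambda>a \<in> X. a) t = t"
  using seqsD[of t X] by (auto intro!: map_idI)

lemma map_compose: "t \<in> seqs X \<Longrightarrow> map (compose X g f) t = map g (map f t)"
  using seqsD[of t X] by (auto simp: compose_def)

lemma map_seq_mor_id: "u \<in> Hom2 (SX X) s t \<Longrightarrow> map_seq_mor (\<lambda>a \<in> X. a) u = u"
  using SX_Hom2D[of u X s t] map_restrict_id by (auto simp: Hom2_SX)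

lemma map_seq_mor_compose:
  "u \<in> Hom2 (SX X) s t \<Longrightarrow> map_seq_mor (compose X g f) u = map_seq_mor g (map_seq_mor f u)"
  using SX_Hom2D[of u X s t] map_compose by (auto simp: Hom2_SX simp del: map_eq_conv)

lemma family_arrow_eqI:
  fixes h k :: "('d, 'x, 'i, 'a) family_arrow"
  assumes "mdom h = mdom k" "mcod h = mcod k" "mfun h = mfun k" "mfam h = mfam k"
  shows "h = k"
  using assms by simp

section \<open>The category of semi-categories\<close>

context bicategory
begin

lemma semi_functor_Id:
  assumes "semi_category M A"
  shows "semi_functor M (Id (SemiCat M) A)"
proof -
  interpret A: semi_category M A by fact
  show ?thesis
  proof (rule semi_functor.intro, goal_cases)
    case (7 a b c)
    then show ?case
      using id_vcomp[OF A.scomp[of a b c]] vcomp_id[OF A.scomp[of a b c]]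
        tens2_id[OF A.shom[of a b] A.shom[of b c]] by simp
  qed (use assms id2_Hom2[OF A.shom] in auto)
qed

text \<open>The squares of \<open>h\<close> and \<open>k\<close> are pasted, and interchange turns
  the two stacked tensors into one tensor of vertical composites.\<close>

lemma semi_functor_Comp:
  assumes "semi_functor M h" "semi_functor M k" "mcod h = mdom k"
  shows "semi_functor M (Comp (SemiCat M) k h)"
proof -
  interpret h: semi_functor M h by fact
  interpret k: semi_functor M k by fact
  interpret A: semi_category M "mdom h" by (rule h.mdom)
  interpret B: semi_category M "mdom k" by (rule k.mdom)
  interpret C: semi_category M "mcod k" by (rule k.mcod)
  let ?f = "mfun h"
  note hB = h.mfam[unfolded assms(3)]
  have f: "?f a \<in> sset (mdom k)" if "a \<in> sset (mdom h)" for a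
    using h.mfun that assms(3) by auto
  have g: "mfun k a \<in> sset (mcod k)" if "a \<in> sset (mdom k)" for a
    using k.mfun that by auto
  show ?thesis
  proof (rule semi_functor.intro, goal_cases)
    case 1 show ?case using h.mdom by simp
  next
    case 2 show ?case using k.mcod by simp
  next
    case 3 show ?case using f g by (auto simp: compose_def)
  next
    case (4 a) then show ?case using f h.mfun_over k.mfun_over assms(3) by (simp add: compose_def)
  next
    case (5 a b) then show ?case
      using vcomp_Hom2[OF hB k.mfam] f by (simp add: compose_def)
  next
    case 6 show ?case by simp
  next
    case (7 a b c)
    then have abc: "a \<in> sset (mdom h)" "b \<in> sset (mdom h)" "c \<in> sset (mdom h)" by simp_all
    note F = f[OF abc(1)] f[OF abc(2)] f[OF abc(3)]
    note hh = tens2_Hom[OF A.shom[OF abc(1,2)] A.shom[OF abc(2,3)] hB[OF abc(1,2)] hB[OF abc(2,3)]]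
    note kk = tens2_Hom[OF B.shom[OF F(1,2)] B.shom[OF F(2,3)] k.mfam[OF F(1,2)] k.mfam[OF F(2,3)]]
    note G = g[OF F(1)] g[OF F(2)] g[OF F(3)]
    have "mfam k (?f a, ?f c) \<bullet> mfam h (a, c) \<bullet> scomp (mdom h) a b c
        = mfam k (?f a, ?f c) \<bullet> (scomp (mdom k) (?f a) (?f b) (?f c) \<bullet> (mfam h (a, b) \<star> mfam h (b, c)))"
      using vcomp_assoc[OF A.scomp hB k.mfam] abc F h.mfam_comp[OF abc] assms(3) by simp
    also have "\<dots> = scomp (mcod k) (mfun k (?f a)) (mfun k (?f b)) (mfun k (?f c))
        \<bullet> (mfam k (?f a, ?f b) \<star> mfam k (?f b, ?f c)) \<bullet> (mfam h (a, b) \<star> mfam h (b, c))"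
      using vcomp_assoc[OF hh B.scomp k.mfam] F k.mfam_comp[OF F] by simp
    also have "\<dots> = scomp (mcod k) (mfun k (?f a)) (mfun k (?f b)) (mfun k (?f c))
        \<bullet> ((mfam k (?f a, ?f b) \<bullet> mfam h (a, b)) \<star> (mfam k (?f b, ?f c) \<bullet> mfam h (b, c)))"
      using vcomp_assoc[OF hh kk C.scomp[OF G]]
        interchange[OF A.shom[OF abc(1,2)] A.shom[OF abc(2,3)] hB[OF abc(1,2)] k.mfam[OF F(1,2)]
          hB[OF abc(2,3)] k.mfam[OF F(2,3)]] by simp
    finally show ?case using abc by (simp add: compose_def)
  qed
qed

lemma category_SemiCat: "category (SemiCat M)"
proof (rule category.intro, goal_cases)
  case (1 h) then show ?case by (simp add: semi_functor.mdom)
next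
  case (2 h) then show ?case by (simp add: semi_functor.mcod)
next
  case (3 A) then show ?case by (simp add: hom_def semi_functor_Id)
next
  case (4 h A B k) then show ?case by (auto simp: hom_def semi_functor_Comp)
next
  case (5 h A B)
  then interpret h: semi_functor M h by (simp add: hom_def)
  show ?case
  proof (rule family_arrow_eqI)
    show "mfun (Comp (SemiCat M) h (Id (SemiCat M) A)) = mfun h"
      using 5 h.mfun by (auto simp: hom_def compose_def fun_eq_iff PiE_def extensional_def)
    show "mfam (Comp (SemiCat M) h (Id (SemiCat M) A)) = mfam h"
      by (rule extensionalityI[OF _ h.mfam_ext])
        (use 5 vcomp_id[OF h.mfam] in \<open>auto simp: hom_def\<close>)
  qed (use 5 in \<open>auto simp: hom_def\<close>)
next
  case (6 h A B)
  then interpret h: semi_functor M h by (simp add: hom_def)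
  show ?case
  proof (rule family_arrow_eqI)
    show "mfun (Comp (SemiCat M) (Id (SemiCat M) B) h) = mfun h"
      by (rule extensionalityI[of _ "sset (mdom h)"])
        (use 6 h.mfun in \<open>auto simp: hom_def compose_def PiE_def Pi_def\<close>)
    show "mfam (Comp (SemiCat M) (Id (SemiCat M) B) h) = mfam h"
      by (rule extensionalityI[OF _ h.mfam_ext])
        (use 6 id_vcomp[OF h.mfam] h.mfun in \<open>auto simp: hom_def PiE_def Pi_def\<close>)
  qed (use 6 in \<open>auto simp: hom_def\<close>)
next
  case (7 h A B k C l D)
  then interpret h: semi_functor M h by (simp add: hom_def)
  from 7 interpret k: semi_functor M k by (simp add: hom_def)
  from 7 interpret l: semi_functor M l by (simp add: hom_def)
  have d: "mdom h = A" "mcod h = B" "mdom k = B" "mcod k = C" "mdom l = C"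
    using 7 by (auto simp: hom_def)
  have f: "\<And>a. a \<in> sset A \<Longrightarrow> mfun h a \<in> sset B" "\<And>a. a \<in> sset B \<Longrightarrow> mfun k a \<in> sset C"
    using h.mfun k.mfun d by auto
  show ?case
  proof (rule family_arrow_eqI)
    show "mfam (Comp (SemiCat M) (Comp (SemiCat M) l k) h) = mfam (Comp (SemiCat M) l (Comp (SemiCat M) k h))"
    proof (rule extensionalityI[of _ "sset A \<times> sset A"])
      fix x assume "x \<in> sset A \<times> sset A"
      then obtain a b where x: "x = (a, b)" "a \<in> sset A" "b \<in> sset A" by auto
      show "mfam (Comp (SemiCat M) (Comp (SemiCat M) l k) h) x = mfam (Comp (SemiCat M) l (Comp (SemiCat M) k h)) x"
        using vcomp_assoc[OF h.mfam[of a b, unfolded d] k.mfam[unfolded d] l.mfam[unfolded d]] x f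
        by (simp add: d compose_def)
    qed (simp_all add: d)
  qed (use f in \<open>auto simp: d compose_def fun_eq_iff\<close>)
qed

section \<open>The category of strict Co-Segal diagrams\<close>

lemma diagram_morphism_Id:
  assumes "SX_diagram M (X, F)"
  shows "diagram_morphism M (Id (StrictCoSegal M) (X, F))"
proof -
  interpret seq_diagram M X F using assms seq_diagram_iff bicategory_axioms by blast
  have l: "\<And>t. t \<in> seqs X \<Longrightarrow> id2 M (lmap1 F t) \<in> Hom2 M (lmap1 F t) (lmap1 F t)"
    using id2_Hom2 lmap1_Hom1 by blast
  have "lmap2 F u \<bullet> id2 M (lmap1 F t) = id2 M (lmap1 F s) \<bullet> lmap2 F u"
    if "u \<in> Hom2 (SX X) s t" for u s t
    using lmap2_Hom2[OF that] vcomp_id id_vcomp by metis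
  moreover have "id2 M (lmap1 F (concat_seq s t)) \<bullet> laxity F s t
      = laxity F s t \<bullet> (id2 M (lmap1 F s) \<star> id2 M (lmap1 F t))"
    if "s \<in> seqs X" "t \<in> seqs X" "last s = hd t" for s t
    using laxity_Hom2[OF that] tens2_id[of "lmap1 F s" _ _ "lmap1 F t"] lmap1_Hom1[OF that(1)]
      lmap1_Hom1[OF that(2)] that(3) vcomp_id id_vcomp by metis
  ultimately show ?thesis
    using assms l by (subst diagram_morphism_iff[where X=X and Y=X and F=F and G=F])
      (auto simp: map_restrict_id map_seq_mor_id concat_seqs SX_Hom2D)
qed

text \<open>The conditions on \<open>k\<close> are used at the image sequences
  \<open>map (mfun h) t\<close>, and their squares are pasted with those of \<open>h\<close>.
  Interchange enters only for laxity, where two tensors are stacked.\<close>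

lemma diagram_morphism_Comp:
  assumes "diagram_morphism M h" "diagram_morphism M k" "mcod h = mdom k"
  shows "diagram_morphism M (Comp (StrictCoSegal M) k h)"
proof -
  obtain X F Y G Z H where d: "mdom h = (X, F)" "mcod h = (Y, G)" "mdom k = (Y, G)" "mcod k = (Z, H)"
    using assms(3) by (metis prod.collapse)
  note h = assms(1)[unfolded diagram_morphism_iff[OF d(1,2)]]
    and k = assms(2)[unfolded diagram_morphism_iff[OF d(3,4)]]
  interpret F: seq_diagram M X F using h seq_diagram_iff bicategory_axioms by blast
  interpret G: seq_diagram M Y G using h seq_diagram_iff bicategory_axioms by blast
  interpret H: seq_diagram M Z H using k seq_diagram_iff bicategory_axioms by blast
  let ?f = "mfun h" and ?g = "mfun k"
  have f: "?f \<in> X \<rightarrow> Y" and g: "?g \<in> Y \<rightarrow> Z" using h k by auto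
  have hm: "mfam h t \<in> Hom2 M (lmap1 F t) (lmap1 G (map ?f t))" if "t \<in> seqs X" for t
    using h that by blast
  have km: "mfam k (map ?f t) \<in> Hom2 M (lmap1 G (map ?f t)) (lmap1 H (map ?g (map ?f t)))"
    if "t \<in> seqs X" for t
    using k map_seqs[OF that f] by blast
  have hn: "\<And>u s t. u \<in> Hom2 (SX X) s t
      \<Longrightarrow> lmap2 G (map_seq_mor ?f u) \<bullet> mfam h t = mfam h s \<bullet> lmap2 F u"
    using h by blast
  have kn: "\<And>u s t. u \<in> Hom2 (SX Y) s t
      \<Longrightarrow> lmap2 H (map_seq_mor ?g u) \<bullet> mfam k t = mfam k s \<bullet> lmap2 G u"
    using k by blast
  have nat: "lmap2 H (map_seq_mor ?g (map_seq_mor ?f u)) \<bullet> (mfam k (map ?f t) \<bullet> mfam h t)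
      = mfam k (map ?f s) \<bullet> mfam h s \<bullet> lmap2 F u" if u: "u \<in> Hom2 (SX X) s t" for u s t
  proof -
    note fu = map_seq_mor_Hom2[OF u f]
    note gfu = map_seq_mor_Hom2[OF fu g]
    note st = SX_Hom2D(1,2)[OF u]
    have "lmap2 H (map_seq_mor ?g (map_seq_mor ?f u)) \<bullet> (mfam k (map ?f t) \<bullet> mfam h t)
        = lmap2 H (map_seq_mor ?g (map_seq_mor ?f u)) \<bullet> mfam k (map ?f t) \<bullet> mfam h t"
      using vcomp_assoc[OF hm km H.lmap2_Hom2[OF gfu]] st by simp
    also have "\<dots> = mfam k (map ?f s) \<bullet> lmap2 G (map_seq_mor ?f u) \<bullet> mfam h t"
      using kn[OF fu] by simp
    also have "\<dots> = mfam k (map ?f s) \<bullet> (lmap2 G (map_seq_mor ?f u) \<bullet> mfam h t)"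
      using vcomp_assoc[OF hm[OF st(2)] G.lmap2_Hom2[OF fu] km[OF st(1)]] .
    also have "\<dots> = mfam k (map ?f s) \<bullet> (mfam h s \<bullet> lmap2 F u)"
      using hn[OF u] by simp
    also have "\<dots> = mfam k (map ?f s) \<bullet> mfam h s \<bullet> lmap2 F u"
      using vcomp_assoc[OF F.lmap2_Hom2[OF u] hm[OF st(1)] km[OF st(1)]] by simp
    finally show ?thesis .
  qed
  have lax: "mfam k (map ?f (concat_seq s t)) \<bullet> mfam h (concat_seq s t) \<bullet> laxity F s t
      = laxity H (map ?g (map ?f s)) (map ?g (map ?f t))
        \<bullet> ((mfam k (map ?f s) \<bullet> mfam h s) \<star> (mfam k (map ?f t) \<bullet> mfam h t))"
    if s: "s \<in> seqs X" and t: "t \<in> seqs X" and e: "last s = hd t" for s t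
  proof -
    note st = concat_seqs(1)[OF s t]
    have fe: "last (map ?f s) = hd (map ?f t)" using map_seq_ends[OF s] map_seq_ends[OF t] e by metis
    have ge: "last (map ?g (map ?f s)) = hd (map ?g (map ?f t))"
      using map_seq_ends[OF map_seqs[OF s f]] map_seq_ends[OF map_seqs[OF t f]] fe by metis
    note fs = map_seqs[OF s f] and ft = map_seqs[OF t f]
    note Fs = F.lmap1_Hom1[OF s, unfolded e] and Ft = F.lmap1_Hom1[OF t]
    note Gs = G.lmap1_Hom1[OF fs, unfolded fe] and Gt = G.lmap1_Hom1[OF ft]
    note hh = tens2_Hom[OF Fs Ft hm[OF s] hm[OF t]]
    note kk = tens2_Hom[OF Gs Gt km[OF s] km[OF t]]
    note lg = G.laxity_Hom2[OF fs ft fe, folded map_concat_seq]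
    have "mfam k (map ?f (concat_seq s t)) \<bullet> mfam h (concat_seq s t) \<bullet> laxity F s t
        = mfam k (map ?f (concat_seq s t)) \<bullet> (mfam h (concat_seq s t) \<bullet> laxity F s t)"
      using vcomp_assoc[OF F.laxity_Hom2[OF s t e] hm[OF st] km[OF st]] .
    also have "\<dots> = mfam k (map ?f (concat_seq s t)) \<bullet> (laxity G (map ?f s) (map ?f t) \<bullet> (mfam h s \<star> mfam h t))"
      using h s t e by auto
    also have "\<dots> = mfam k (map ?f (concat_seq s t)) \<bullet> laxity G (map ?f s) (map ?f t) \<bullet> (mfam h s \<star> mfam h t)"
      using vcomp_assoc[OF hh lg km[OF st]] by simp
    also have "\<dots> = laxity H (map ?g (map ?f s)) (map ?g (map ?f t))
        \<bullet> (mfam k (map ?f s) \<star> mfam k (map ?f t)) \<bullet> (mfam h s \<star> mfam h t)"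
      using k fs ft fe by (simp only: map_concat_seq)
    also have "\<dots> = laxity H (map ?g (map ?f s)) (map ?g (map ?f t))
        \<bullet> ((mfam k (map ?f s) \<star> mfam k (map ?f t)) \<bullet> (mfam h s \<star> mfam h t))"
      using vcomp_assoc[OF hh kk H.laxity_Hom2[OF map_seqs[OF fs g] map_seqs[OF ft g] ge]] .
    also have "\<dots> = laxity H (map ?g (map ?f s)) (map ?g (map ?f t))
        \<bullet> ((mfam k (map ?f s) \<bullet> mfam h s) \<star> (mfam k (map ?f t) \<bullet> mfam h t))"
      using interchange[OF Fs Ft hm[OF s] km[OF s] hm[OF t] km[OF t]] by simp
    finally show ?thesis .
  qed
  have gf: "compose X ?g ?f \<in> X \<rightarrow>\<^sub>E Z" using f g by (auto simp: compose_def)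
  have over: "\<forall>A\<in>X. lob H (compose X ?g ?f A) = lob F A" using h k f by (simp add: compose_def Pi_def)
  have fam: "mfam k (map ?f t) \<bullet> mfam h t \<in> Hom2 M (lmap1 F t) (lmap1 H (map (compose X ?g ?f) t))"
    if "t \<in> seqs X" for t
    using vcomp_Hom2[OF hm km] map_compose[OF that] that by metis
  have c: "mdom (Comp (StrictCoSegal M) k h) = (X, F)" "mcod (Comp (StrictCoSegal M) k h) = (Z, H)"
    using d by simp_all
  show ?thesis
    unfolding diagram_morphism_iff[OF c] StrictCoSegal_simps d fst_conv
  proof (intro conjI allI ballI impI, goal_cases)
    case (7 u s t)
    then show ?case using nat[OF 7] SX_Hom2D(1,2)[OF 7] by (simp only: restrict_apply if_True map_seq_mor_compose[OF 7])
  next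
    case (8 s t)
    then show ?case using lax[OF 8] 8 concat_seqs(1)[OF 8(1,2)]
      by (simp only: restrict_apply if_True map_compose[OF 8(1)] map_compose[OF 8(2)])
  qed (use h k gf over fam in auto)
qed

text \<open>The Co-Segal condition constrains objects only, so identities and composites are
  inherited from diagrams. The category laws are then equalities of extensional families, checked at
  each sequence.\<close>

lemma category_StrictCoSegal: "category (StrictCoSegal M)"
proof (rule category.intro, goal_cases)
  case (3 D)
  then have "diagram_morphism M (Id (StrictCoSegal M) D)"
    using diagram_morphism_Id[of "fst D" "snd D"] by (simp add: strict_co_segal_def)
  then show ?case using 3 by (simp add: hom_def)
next
  case (4 h A B k) then show ?case by (auto simp: hom_def diagram_morphism_Comp)
next
  case (5 h A B)
  obtain X F Y G where d: "A = (X, F)" "B = (Y, G)" by fastforce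
  then have m: "mdom h = (X, F)" "mcod h = (Y, G)" "diagram_morphism M h" using 5 by (auto simp: hom_def)
  note h = m(3)[unfolded diagram_morphism_iff[OF m(1,2)]]
  have hm: "\<And>t. t \<in> seqs X \<Longrightarrow> mfam h t \<in> Hom2 M (lmap1 F t) (lmap1 G (map (mfun h) t))"
    using h by blast
  show ?case
  proof (rule family_arrow_eqI)
    show "mfun (Comp (StrictCoSegal M) h (Id (StrictCoSegal M) A)) = mfun h"
      by (rule extensionalityI[of _ X]) (use h d in \<open>simp_all add: compose_def PiE_def\<close>)
    show "mfam (Comp (StrictCoSegal M) h (Id (StrictCoSegal M) A)) = mfam h"
      by (rule extensionalityI[of _ "seqs X"])
        (use h d vcomp_id[OF hm] map_restrict_id[of _ X] in \<open>auto simp del: map_eq_conv\<close>)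
  qed (use m d in auto)
next
  case (6 h A B)
  obtain X F Y G where d: "A = (X, F)" "B = (Y, G)" by fastforce
  then have m: "mdom h = (X, F)" "mcod h = (Y, G)" "diagram_morphism M h" using 6 by (auto simp: hom_def)
  note h = m(3)[unfolded diagram_morphism_iff[OF m(1,2)]]
  have hm: "\<And>t. t \<in> seqs X \<Longrightarrow> mfam h t \<in> Hom2 M (lmap1 F t) (lmap1 G (map (mfun h) t))"
    using h by blast
  have f: "mfun h \<in> X \<rightarrow> Y" using h by auto
  show ?case
  proof (rule family_arrow_eqI)
    show "mfun (Comp (StrictCoSegal M) (Id (StrictCoSegal M) B) h) = mfun h"
      by (rule extensionalityI[of _ X]) (use h d m f in \<open>simp_all add: compose_def PiE_def Pi_def\<close>)
    show "mfam (Comp (StrictCoSegal M) (Id (StrictCoSegal M) B) h) = mfam h"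
      by (rule extensionalityI[of _ "seqs X"])
        (use h d m id_vcomp[OF hm] map_seqs[OF _ f] in auto)
  qed (use m d in auto)
next
  case (7 h A B k C l D)
  obtain X F Y G Z H where d: "A = (X, F)" "B = (Y, G)" "C = (Z, H)" by (metis prod.collapse)
  then have m: "mdom h = (X, F)" "mcod h = (Y, G)" "diagram_morphism M h"
    "mdom k = (Y, G)" "mcod k = (Z, H)" "diagram_morphism M k"
    "mdom l = (Z, H)" "diagram_morphism M l" using 7 by (auto simp: hom_def)
  obtain V I where ml: "mcod l = (V, I)" by fastforce
  note h = m(3)[unfolded diagram_morphism_iff[OF m(1,2)]]
    and k = m(6)[unfolded diagram_morphism_iff[OF m(4,5)]]
    and l = m(8)[unfolded diagram_morphism_iff[OF m(7) ml]]
  have f: "mfun h \<in> X \<rightarrow> Y" and g: "mfun k \<in> Y \<rightarrow> Z" using h k by auto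
  have hm: "\<And>t. t \<in> seqs X \<Longrightarrow> mfam h t \<in> Hom2 M (lmap1 F t) (lmap1 G (map (mfun h) t))"
    and km: "\<And>t. t \<in> seqs Y \<Longrightarrow> mfam k t \<in> Hom2 M (lmap1 G t) (lmap1 H (map (mfun k) t))"
    and lm: "\<And>t. t \<in> seqs Z \<Longrightarrow> mfam l t \<in> Hom2 M (lmap1 H t) (lmap1 I (map (mfun l) t))"
    subgoal using h by blast
    subgoal using k by blast
    subgoal using l by blast
    done
  show ?case
  proof (rule family_arrow_eqI)
    show "mfam (Comp (StrictCoSegal M) (Comp (StrictCoSegal M) l k) h)
        = mfam (Comp (StrictCoSegal M) l (Comp (StrictCoSegal M) k h))"
    proof (rule extensionalityI[of _ "seqs X"])
      fix t assume t: "t \<in> seqs X"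
      note ft = map_seqs[OF t f]
      note gt = map_seqs[OF ft g]
      show "mfam (Comp (StrictCoSegal M) (Comp (StrictCoSegal M) l k) h) t
          = mfam (Comp (StrictCoSegal M) l (Comp (StrictCoSegal M) k h)) t"
        using vcomp_assoc[OF hm[OF t] km[OF ft] lm[OF gt]] t ft
        by (simp only: StrictCoSegal_simps m fst_conv restrict_apply if_True map_compose[OF t])
    qed (simp_all add: m)
  qed (use f in \<open>auto simp: m compose_def fun_eq_iff\<close>)
qed auto

text \<open>Over the identity of \<open>X\<close>, inverting each component suffices:
  \<open>inverse2_square\<close> makes the inverse family natural, and with
  \<open>tens2_inverse2\<close> for the tensored side also compatible with laxity.\<close>

lemma is_iso_StrictCoSegal:
  assumes h: "diagram_morphism M h" "strict_co_segal M (X, F)" "strict_co_segal M (X, G)"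
    and m: "mdom h = (X, F)" "mcod h = (X, G)" "mfun h = (\<lambda>a \<in> X. a)"
    and inv: "\<And>t. t \<in> seqs X \<Longrightarrow> inverse2 (mfam h t) (n t)"
  shows "is_iso (StrictCoSegal M) h"
proof -
  interpret F: co_segal_diagram M X F using h co_segal_diagram_iff bicategory_axioms by blast
  interpret G: co_segal_diagram M X G using h co_segal_diagram_iff bicategory_axioms by blast
  note hh = h(1)[unfolded diagram_morphism_iff[OF m(1,2)] m(3)]
  have hm: "mfam h t \<in> Hom2 M (lmap1 F t) (lmap1 G t)" if "t \<in> seqs X" for t
    using hh that map_restrict_id by metis
  note n = inverse2D[OF inv hm]
  define k where "k = \<lparr>mdom = (X, G), mcod = (X, F), mfun = (\<lambda>a \<in> X. a), mfam = restrict n (seqs X)\<rparr>"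
  have c: "mdom k = (X, G)" "mcod k = (X, F)" "mfun k = (\<lambda>a \<in> X. a)" "mfam k = restrict n (seqs X)"
    by (simp_all add: k_def)
  have "diagram_morphism M k"
    unfolding diagram_morphism_iff[OF c(1,2)] c(3,4)
  proof (intro conjI allI ballI impI, goal_cases)
    case (4 A) then show ?case using hh by auto
  next
    case (5 t) then show ?case using n map_restrict_id[OF 5] by (simp del: map_eq_conv)
  next
    case (7 u s t)
    note st = SX_Hom2D(1,2)[OF 7]
    have "lmap2 G u \<bullet> mfam h t = mfam h s \<bullet> lmap2 F u" using hh 7 map_seq_mor_id[OF 7] by metis
    then show ?case
      using inverse2_square[OF inv hm inv hm F.lmap2_Hom2[OF 7] G.lmap2_Hom2[OF 7]] st
        map_seq_mor_id[OF 7] by simp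
  next
    case (8 s t)
    have Fs: "lmap1 F s \<in> Hom1 M (lob F (hd s)) (lob F (hd t))" using F.lmap1_Hom1[OF 8(1)] 8(3) by simp
    note a = tens2_Hom[OF Fs F.lmap1_Hom1[OF 8(2)] hm[OF 8(1)] hm[OF 8(2)]]
      and a' = tens2_inverse2[OF Fs F.lmap1_Hom1[OF 8(2)] hm[OF 8(1)] hm[OF 8(2)] inv[OF 8(1)] inv[OF 8(2)]]
    note st = concat_seqs(1)[OF 8(1,2)]
    have "laxity G s t \<bullet> (mfam h s \<star> mfam h t) = mfam h (concat_seq s t) \<bullet> laxity F s t"
      using hh 8 map_restrict_id by metis
    then show ?case
      using inverse2_square[OF a' a inv[OF st] hm[OF st] F.laxity_Hom2[OF 8] G.laxity_Hom2[OF 8]]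
        st 8 map_restrict_id[OF 8(1)] map_restrict_id[OF 8(2)] by (simp del: map_eq_conv)
  qed (use h in \<open>auto simp: strict_co_segal_def\<close>)
  moreover have "Comp (StrictCoSegal M) k h = Id (StrictCoSegal M) (X, F)"
    by (rule family_arrow_eqI) (use n map_restrict_id[of _ X] in \<open>auto simp: m c compose_def fun_eq_iff simp del: map_eq_conv\<close>)
  moreover have "Comp (StrictCoSegal M) h k = Id (StrictCoSegal M) (X, G)"
    by (rule family_arrow_eqI) (use n map_restrict_id[of _ X] in \<open>auto simp: m c compose_def fun_eq_iff simp del: map_eq_conv\<close>)
  ultimately show ?thesis using h by (auto simp: is_iso_def hom_def m c intro!: exI[of _ k])
qed

end

section \<open>The equivalence\<close>

text \<open>Arrows of sequences preserve both ends, so the values at source and target coincide and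
  every arrow can act as an identity. Restriction and \<open>undefined\<close> provide the
  extensionality demanded of diagrams.\<close>

definition const_diagram ::
  "('u, 'f, 'a, 'z) bicat_scheme \<Rightarrow> ('x, 'u, 'f, 'a) semicat \<Rightarrow> ('x, 'u, 'f, 'a) diagram" where
  "const_diagram M A = (sset A,
    \<lparr>lob = sob A,
     lmap1 = (\<lambda>t \<in> seqs (sset A). shom A (hd t) (last t)),
     lmap2 = (\<lambda>u \<in> seq_mors (sset A). id2 M (shom A (hd (fst u)) (last (fst u)))),
     laxity = (\<lambda>s t. if s \<in> seqs (sset A) \<and> t \<in> seqs (sset A) \<and> last s = hd t
       then scomp A (hd s) (hd t) (last t) else undefined)\<rparr>)"

definition const_arrow ::
  "('u, 'f, 'a, 'z) bicat_scheme \<Rightarrow> (('x, 'u, 'f, 'a) semicat, 'x, 'x \<times> 'x, 'a) family_arrow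
    \<Rightarrow> (('x, 'u, 'f, 'a) diagram, 'x, 'x list, 'a) family_arrow" where
  "const_arrow M h = \<lparr>mdom = const_diagram M (mdom h), mcod = const_diagram M (mcod h),
    mfun = mfun h, mfam = (\<lambda>t \<in> seqs (sset (mdom h)). mfam h (hd t, last t))\<rparr>"

text \<open>The \<open>undefined\<close> branches make the families extensional, so that a
  semi-category can be recovered literally from its constant diagram.\<close>

definition segal_semicat ::
  "('u, 'f, 'a, 'z) bicat_scheme \<Rightarrow> ('x, 'u, 'f, 'a) diagram \<Rightarrow> ('x, 'u, 'f, 'a) semicat" where
  "segal_semicat M D =
    \<lparr>sset = fst D,
     sob = lob (snd D),
     shom = (\<lambda>A B. if A \<in> fst D \<and> B \<in> fst D then lmap1 (snd D) [A, B] else undefined),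
     scomp = (\<lambda>A B C. if A \<in> fst D \<and> B \<in> fst D \<and> C \<in> fst D
       then co_segal_diagram.segal_comp M (snd D) A B C else undefined)\<rparr>"

definition segal_arrow ::
  "('u, 'f, 'a, 'z) bicat_scheme \<Rightarrow> (('x, 'u, 'f, 'a) diagram, 'x, 'x list, 'a) family_arrow
    \<Rightarrow> (('x, 'u, 'f, 'a) semicat, 'x, 'x \<times> 'x, 'a) family_arrow" where
  "segal_arrow M h = \<lparr>mdom = segal_semicat M (mdom h), mcod = segal_semicat M (mcod h),
    mfun = mfun h, mfam = (\<lambda>(a, b) \<in> fst (mdom h) \<times> fst (mdom h). mfam h [a, b])\<rparr>"

definition segal_counit ::
  "('u, 'f, 'a, 'z) bicat_scheme \<Rightarrow> ('x, 'u, 'f, 'a) diagram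
    \<Rightarrow> (('x, 'u, 'f, 'a) diagram, 'x, 'x list, 'a) family_arrow" where
  "segal_counit M D = \<lparr>mdom = const_diagram M (segal_semicat M D), mcod = D,
    mfun = (\<lambda>a \<in> fst D. a), mfam = (\<lambda>t \<in> seqs (fst D). lmap2 (snd D) (collapse t))\<rparr>"

lemma const_diagram_simps [simp]:
  "fst (const_diagram M A) = sset A" "lob (snd (const_diagram M A)) = sob A"
  "t \<in> seqs (sset A) \<Longrightarrow> lmap1 (snd (const_diagram M A)) t = shom A (hd t) (last t)"
  "\<lbrakk>s \<in> seqs (sset A); t \<in> seqs (sset A); last s = hd t\<rbrakk>
    \<Longrightarrow> laxity (snd (const_diagram M A)) s t = scomp A (hd s) (hd t) (last t)"
  by (simp_all add: const_diagram_def)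

lemma const_diagram_lmap2:
  "u \<in> Hom2 (SX (sset A)) s t \<Longrightarrow> lmap2 (snd (const_diagram M A)) u = id2 M (shom A (hd s) (last s))"
  by (auto simp: const_diagram_def Hom2_SX)

lemma const_arrow_simps [simp]:
  "mdom (const_arrow M h) = const_diagram M (mdom h)" "mcod (const_arrow M h) = const_diagram M (mcod h)"
  "mfun (const_arrow M h) = mfun h"
  "mfam (const_arrow M h) = (\<lambda>t \<in> seqs (sset (mdom h)). mfam h (hd t, last t))"
  by (simp_all add: const_arrow_def)

lemma segal_semicat_simps [simp]:
  "sset (segal_semicat M D) = fst D" "sob (segal_semicat M D) = lob (snd D)"
  "A \<in> fst D \<Longrightarrow> B \<in> fst D \<Longrightarrow> shom (segal_semicat M D) A B = lmap1 (snd D) [A, B]"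
  "A \<in> fst D \<Longrightarrow> B \<in> fst D \<Longrightarrow> C \<in> fst D
    \<Longrightarrow> scomp (segal_semicat M D) A B C = co_segal_diagram.segal_comp M (snd D) A B C"
  by (simp_all add: segal_semicat_def)

lemma segal_arrow_simps [simp]:
  "mdom (segal_arrow M h) = segal_semicat M (mdom h)" "mcod (segal_arrow M h) = segal_semicat M (mcod h)"
  "mfun (segal_arrow M h) = mfun h"
  "mfam (segal_arrow M h) = (\<lambda>(a, b) \<in> fst (mdom h) \<times> fst (mdom h). mfam h [a, b])"
  by (simp_all add: segal_arrow_def)

lemma segal_counit_simps [simp]:
  "mdom (segal_counit M D) = const_diagram M (segal_semicat M D)" "mcod (segal_counit M D) = D"
  "mfun (segal_counit M D) = (\<lambda>a \<in> fst D. a)"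
  "mfam (segal_counit M D) = (\<lambda>t \<in> seqs (fst D). lmap2 (snd D) (collapse t))"
  by (simp_all add: segal_counit_def)

section \<open>From semi-categories to constant diagrams\<close>

context bicategory
begin

text \<open>The laxity depends only on three ends, which arrows preserve, so naturality merely
  absorbs identities; the coherence law is \<open>sassoc\<close> at \<open>hd r\<close>,
  \<open>hd s\<close>, \<open>hd t\<close>, \<open>last t\<close>. An identity is its own inverse,
  which gives the Co-Segal condition.\<close>

lemma strict_co_segal_const_diagram:
  assumes "semi_category M A"
  shows "strict_co_segal M (const_diagram M A)"
proof -
  interpret A: semi_category M A by fact
  define X F where XF: "X = sset A" "F = snd (const_diagram M A)"
  have D: "const_diagram M A = (X, F)" by (simp add: XF prod_eq_iff)
  have l1: "lmap1 F t = shom A (hd t) (last t)" if "t \<in> seqs X" for t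
    using that by (simp add: XF)
  have sh: "shom A (hd t) (last t) \<in> Hom1 M (sob A (hd t)) (sob A (last t))" if "t \<in> seqs X" for t
    using A.shom seqs_ends[OF that] XF by simp
  have l2: "lmap2 F u = id2 M (shom A (hd s) (last s))" if "u \<in> Hom2 (SX X) s t" for u s t
    using that const_diagram_lmap2 XF by metis
  have lax: "laxity F s t = scomp A (hd s) (hd t) (last t)" if "s \<in> seqs X" "t \<in> seqs X" "last s = hd t" for s t
    using that by (simp add: XF)
  note i = id2_Hom2[OF sh]
  have sc: "laxity F s t \<in> Hom2 M (lmap1 F s \<otimes> lmap1 F t) (lmap1 F (concat_seq s t))"
    if st: "s \<in> seqs X" "t \<in> seqs X" "last s = hd t" for s t
    using A.scomp[of "hd s" "hd t" "last t"] seqs_ends[OF st(1)] seqs_ends[OF st(2)] st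
      concat_seqs[OF st(1,2)] by (simp add: l1 lax XF(1)[symmetric])
  have "SX_diagram M (X, F)"
  proof (rule SX_diagramI[OF bicategory_axioms], goal_cases)
    case 1 then show ?case using A.sob by (simp add: XF)
  next
    case 2 then show ?case by (simp add: XF const_diagram_def)
  next
    case 3 then show ?case by (simp add: XF const_diagram_def)
  next
    case 4 then show ?case by (auto simp: XF const_diagram_def extensional_def)
  next
    case (5 t) then show ?case using sh by (simp add: l1) (simp add: XF)
  next
    case (6 u s t) then show ?case using i SX_Hom2D[OF 6] by (simp add: l1 l2[OF 6])
  next
    case (7 t) then show ?case using l2[OF SX_id2_Hom2[OF 7]] by (simp add: l1)
  next
    case (8 u v r s t)
    then show ?case
      using l2[OF 8(1)] l2[OF 8(2)] l2[OF SX_vcomp_Hom2[OF 8]] SX_Hom2D[OF 8(1)] vcomp_id[OF i] by metis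
  next
    case (9 s t) then show ?case by (rule sc)
  next
    case (10 u v s s' t t')
    note s = SX_Hom2D[OF 10(1)] and t = SX_Hom2D[OF 10(2)]
    have e: "last s' = hd t'" using s t 10(3) by simp
    have "lmap2 F u \<star> lmap2 F v = id2 M (lmap1 F s \<otimes> lmap1 F t)"
      using l2[OF 10(1)] l2[OF 10(2)] tens2_id[OF sh[OF s(1)]] sh[OF t(1)] 10(3) l1 s t by simp
    moreover have "lmap2 F (ordinal_sum u v) = id2 M (lmap1 F (concat_seq s t))"
      using l2[OF SX_tens2_Hom2[OF 10]] l1 concat_seqs(1)[OF s(1) t(1)] by simp
    moreover have "laxity F s t = laxity F s' t'"
      using lax[OF s(1) t(1) 10(3)] lax[OF s(2) t(2) e] s t by simp
    ultimately show ?case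
      using vcomp_id[OF sc[OF s(1) t(1) 10(3)]] id_vcomp[OF sc[OF s(1) t(1) 10(3)]] by simp
  next
    case (11 r s t)
    then show ?case
      using A.sassoc[of "hd r" "hd s" "hd t" "last t"] seqs_ends[OF 11(1)] seqs_ends[OF 11(2)]
        seqs_ends[OF 11(3)] concat_seqs[OF 11(1,2)] concat_seqs[OF 11(2,3)]
      by (simp add: l1 lax XF(1)[symmetric])
  qed
  moreover have "is_iso (Hom M (lob F B) (lob F C)) (lmap2 F u)" if u: "u \<in> Arr (Hom (SX X) B C)" for B C u
  proof -
    obtain s t where st: "u \<in> Hom2 (SX X) s t" "hd s = B" "last s = C"
      using u by (auto simp: Hom_def Hom2_def Hom1_SX)
    note s = sh[OF SX_Hom2D(1)[OF st(1)]]
    have "inverse2 (lmap2 F u) (lmap2 F u)"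
      unfolding l2[OF st(1)] using id2_Hom2[OF s] vcomp_id[OF id2_Hom2[OF s]] by (intro inverse2I)
    then show ?thesis
      using is_iso_iff[OF s id2_Hom2[OF s]] st l2[OF st(1)] by (auto simp: XF)
  qed
  ultimately show ?thesis unfolding D strict_co_segal_def by auto
qed

text \<open>The ends of a mapped sequence are the images of its ends, so the component at the ends
  is correctly typed. Both transition maps are identities, and compatibility with laxity is
  \<open>mfam_comp\<close> at the three ends.\<close>

lemma diagram_morphism_const_arrow:
  assumes "semi_functor M h"
  shows "diagram_morphism M (const_arrow M h)"
proof -
  interpret h: semi_functor M h by fact
  interpret A: semi_category M "mdom h" by (rule h.mdom)
  let ?X = "sset (mdom h)" and ?Y = "sset (mcod h)"
  have f: "mfun h \<in> ?X \<rightarrow> ?Y" using h.mfun by auto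
  have d: "mdom (const_arrow M h) = (?X, snd (const_diagram M (mdom h)))"
    "mcod (const_arrow M h) = (?Y, snd (const_diagram M (mcod h)))"
    by (simp_all add: prod_eq_iff)
  note ends = map_seq_ends[of _ ?X "mfun h"]
  show ?thesis
    unfolding diagram_morphism_iff[OF d]
  proof (intro conjI allI ballI impI, goal_cases)
    case 1 then show ?case
      using strict_co_segal_const_diagram[OF h.mdom] d by (simp add: strict_co_segal_def)
  next
    case 2 then show ?case
      using strict_co_segal_const_diagram[OF h.mcod] d by (simp add: strict_co_segal_def)
  next
    case 3 then show ?case using h.mfun by simp
  next
    case (4 A) then show ?case using h.mfun_over by simp
  next
    case (5 t) then show ?case
      using h.mfam[of "hd t" "last t"] seqs_ends[OF 5] map_seqs[OF 5 f] ends[OF 5] by simp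
  next
    case (7 u s t)
    note s = SX_Hom2D[OF 7]
    note m = h.mfam[of "hd s" "last s"]
    have "lmap2 (snd (const_diagram M (mdom h))) u = id2 M (shom (mdom h) (hd s) (last s))"
      using const_diagram_lmap2[OF 7] .
    moreover have "lmap2 (snd (const_diagram M (mcod h))) (map_seq_mor (mfun h) u)
        = id2 M (shom (mcod h) (mfun h (hd s)) (mfun h (last s)))"
      using const_diagram_lmap2[OF map_seq_mor_Hom2[OF 7 f]] ends[OF s(1)] by simp
    ultimately show ?case
      using s seqs_ends[OF s(1)] vcomp_id[OF m] id_vcomp[OF m] by simp
  next
    case (8 s t)
    then show ?case
      using h.mfam_comp[of "hd s" "hd t" "last t"] seqs_ends[OF 8(1)] seqs_ends[OF 8(2)]
        ends[OF 8(1)] ends[OF 8(2)] map_seqs[OF 8(1) f] map_seqs[OF 8(2) f] concat_seqs[OF 8(1,2)]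
      by simp
  qed simp
qed

section \<open>From strict Co-Segal diagrams to semi-categories\<close>

lemma semi_category_segal:
  assumes "strict_co_segal M (X, F)"
  shows "semi_category M (segal_semicat M (X, F))"
proof -
  interpret co_segal_diagram M X F using assms co_segal_diagram_iff bicategory_axioms by blast
  show ?thesis
  proof (rule semi_category.intro, goal_cases)
    case 1 then show ?case using lob by simp
  next
    case (2 a b) then show ?case using lmap1_pair by simp
  next
    case (4 a b c) then show ?case using segal_comp_Hom2 by simp
  next
    case (6 a b c d) then show ?case using segal_comp_assoc by simp
  qed (auto simp: segal_semicat_def extensional_def)
qed

text \<open>Compatibility with composition is tested after the canonical map of \<open>G\<close> at
  the image triple: there \<open>segal_comp\<close> becomes laxity on both sides, and
  \<open>h\<close> respects laxity.\<close>

lemma semi_functor_segal_arrow: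
  assumes "diagram_morphism M h" "strict_co_segal M (mdom h)" "strict_co_segal M (mcod h)"
  shows "semi_functor M (segal_arrow M h)"
proof -
  obtain X F Y G where d: "mdom h = (X, F)" "mcod h = (Y, G)" by fastforce
  note h = assms(1)[unfolded diagram_morphism_iff[OF d]]
  interpret F: co_segal_diagram M X F using assms d co_segal_diagram_iff bicategory_axioms by metis
  interpret G: co_segal_diagram M Y G using assms d co_segal_diagram_iff bicategory_axioms by metis
  let ?f = "mfun h"
  have f: "?f a \<in> Y" if "a \<in> X" for a using h that by (simp add: Pi_def PiE_def)
  have fam: "mfam h t \<in> Hom2 M (lmap1 F t) (lmap1 G (map ?f t))" if "t \<in> seqs X" for t
    using h that by blast
  have nat: "\<And>u s t. u \<in> Hom2 (SX X) s t
      \<Longrightarrow> lmap2 G (map_seq_mor ?f u) \<bullet> mfam h t = mfam h s \<bullet> lmap2 F u"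
    using h by blast
  have comp: "mfam h [a, c] \<bullet> F.segal_comp a b c
      = G.segal_comp (?f a) (?f b) (?f c) \<bullet> (mfam h [a, b] \<star> mfam h [b, c])"
    if X: "a \<in> X" "b \<in> X" "c \<in> X" for a b c
  proof -
    let ?c = "lmap2 G (collapse [?f a, ?f b, ?f c])"
    have t: "[a, b, c] \<in> seqs X" and ft: "[?f a, ?f b, ?f c] \<in> seqs Y" using X f by auto
    have Fc: "lmap2 F (collapse [a, b, c]) \<in> Hom2 M (lmap1 F [a, c]) (lmap1 F [a, b, c])"
      using F.lmap2_collapse_Hom2[OF t] by simp
    have Gc: "?c \<in> Hom2 M (lmap1 G [?f a, ?f c]) (lmap1 G [?f a, ?f b, ?f c])"
      using G.lmap2_collapse_Hom2[OF ft] by simp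
    have ac: "mfam h [a, c] \<in> Hom2 M (lmap1 F [a, c]) (lmap1 G [?f a, ?f c])"
      and ab: "mfam h [a, b] \<in> Hom2 M (lmap1 F [a, b]) (lmap1 G [?f a, ?f b])"
      and bc: "mfam h [b, c] \<in> Hom2 M (lmap1 F [b, c]) (lmap1 G [?f b, ?f c])"
      and abc: "mfam h [a, b, c] \<in> Hom2 M (lmap1 F [a, b, c]) (lmap1 G [?f a, ?f b, ?f c])"
      using fam[of "[a, c]"] fam[of "[a, b]"] fam[of "[b, c]"] fam[of "[a, b, c]"] X by simp_all
    note Fg = F.segal_comp_Hom2[OF X] and Gg = G.segal_comp_Hom2[OF f[OF X(1)] f[OF X(2)] f[OF X(3)]]
    note hh = tens2_Hom[OF F.lmap1_pair[OF X(1,2)] F.lmap1_pair[OF X(2,3)] ab bc]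
    have "?c \<bullet> (mfam h [a, c] \<bullet> F.segal_comp a b c) = ?c \<bullet> mfam h [a, c] \<bullet> F.segal_comp a b c"
      using vcomp_assoc[OF Fg ac Gc] by simp
    \<comment> \<open>Naturality of \<open>h\<close> at the collapse of the triple; the entrywise
      image of a collapse is again a collapse.\<close>
    also have "?c \<bullet> mfam h [a, c] = mfam h [a, b, c] \<bullet> lmap2 F (collapse [a, b, c])"
      using nat[OF collapse_Hom2[OF t]] map_seq_mor_collapse[OF t, of ?f] by simp
    also have "\<dots> \<bullet> F.segal_comp a b c = mfam h [a, b, c] \<bullet> laxity F [a, b] [b, c]"
      using vcomp_assoc[OF Fg Fc abc] F.segal_comp_collapse[OF X] by simp
    also have "\<dots> = laxity G [?f a, ?f b] [?f b, ?f c] \<bullet> (mfam h [a, b] \<star> mfam h [b, c])"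
    proof -
      have "\<forall>s \<in> seqs X. \<forall>t \<in> seqs X. last s = hd t \<longrightarrow>
        mfam h (concat_seq s t) \<bullet> laxity F s t = laxity G (map ?f s) (map ?f t) \<bullet> (mfam h s \<star> mfam h t)"
        using h by blast
      from this[rule_format, of "[a, b]" "[b, c]"] show ?thesis using X by simp
    qed
    also have "\<dots> = ?c \<bullet> (G.segal_comp (?f a) (?f b) (?f c) \<bullet> (mfam h [a, b] \<star> mfam h [b, c]))"
      using vcomp_assoc[OF hh Gg Gc] G.segal_comp_collapse[OF f[OF X(1)] f[OF X(2)] f[OF X(3)]] by simp
    finally show ?thesis
      by (rule inverse2_mono[OF G.collapse_inverse2[OF ft] Gc vcomp_Hom2[OF Fg ac] vcomp_Hom2[OF hh Gg]])
  qed
  show ?thesis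
  proof (rule semi_functor.intro, goal_cases)
    case 1 then show ?case using semi_category_segal assms d by simp
  next
    case 2 then show ?case using semi_category_segal assms d by simp
  next
    case 3 then show ?case using h d by simp
  next
    case (4 a) then show ?case using h d by simp
  next
    case (5 a b) then show ?case using fam[of "[a, b]"] f d by simp
  next
    case (7 a b c) then show ?case using comp f d by simp
  qed simp
qed

section \<open>The two round trips\<close>

lemma segal_const_diagram:
  assumes "semi_category M A"
  shows "segal_semicat M (const_diagram M A) = A"
proof -
  interpret A: semi_category M A by fact
  have D: "const_diagram M A = (sset A, snd (const_diagram M A))" by (simp add: prod_eq_iff)
  interpret F: co_segal_diagram M "sset A" "snd (const_diagram M A)"
    using strict_co_segal_const_diagram[OF assms] co_segal_diagram_iff[OF bicategory_axioms] D by metis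
  have "F.segal_comp a b c = scomp A a b c" if X: "a \<in> sset A" "b \<in> sset A" "c \<in> sset A" for a b c
  proof -
    \<comment> \<open>The canonical map at the triple is an identity, so inverting it leaves the
      laxity, which is \<open>scomp A a b c\<close> itself.\<close>
    have "lmap2 (snd (const_diagram M A)) (collapse [a, b, c]) = id2 M (shom A a c)"
      using const_diagram_lmap2[OF collapse_Hom2[of "[a, b, c]"], of A M] X by simp
    then show ?thesis
      unfolding F.segal_comp_def using inv2_id[OF A.shom[OF X(1,3)]] id_vcomp[OF A.scomp[OF X]] X by simp
  qed
  then have "scomp (segal_semicat M (const_diagram M A)) = scomp A"
    using A.scomp_ext by (auto simp: fun_eq_iff segal_semicat_def extensional_def)
  moreover have "shom (segal_semicat M (const_diagram M A)) = shom A"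
    using A.shom_ext by (auto simp: fun_eq_iff segal_semicat_def extensional_def)
  ultimately show ?thesis by (intro semicat.equality) simp_all
qed

lemma segal_const_arrow:
  assumes "semi_functor M h"
  shows "segal_arrow M (const_arrow M h) = h"
proof (rule family_arrow_eqI)
  interpret h: semi_functor M h by fact
  show "mfam (segal_arrow M (const_arrow M h)) = mfam h"
    by (rule extensionalityI[OF _ h.mfam_ext]) auto
qed (use assms segal_const_diagram semi_functor.mdom semi_functor.mcod in \<open>simp_all, blast+\<close>)

text \<open>Hides the composite construction behind a variable \<open>G\<close> known only through
  its values on sequences in \<open>X\<close>, which keeps the \<open>undefined\<close> branches out
  of the counit proofs.\<close>

lemma const_diagram_segal:
  assumes "strict_co_segal M (X, F)"
  obtains G where "const_diagram M (segal_semicat M (X, F)) = (X, G)" "lob G = lob F"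
    "\<And>t. t \<in> seqs X \<Longrightarrow> lmap1 G t = lmap1 F [hd t, last t]"
    "\<And>s t. \<lbrakk>s \<in> seqs X; t \<in> seqs X; last s = hd t\<rbrakk>
      \<Longrightarrow> laxity G s t = co_segal_diagram.segal_comp M F (hd s) (hd t) (last t)"
    "\<And>u s t. u \<in> Hom2 (SX X) s t \<Longrightarrow> lmap2 G u = id2 M (lmap1 F [hd s, last s])"
proof
  let ?D = "const_diagram M (segal_semicat M (X, F))"
  show "?D = (X, snd ?D)" by (simp add: prod_eq_iff)
  show "lob (snd ?D) = lob F" by simp
  show "lmap1 (snd ?D) t = lmap1 F [hd t, last t]" if "t \<in> seqs X" for t
    using seqs_ends[OF that] that by simp
  show "laxity (snd ?D) s t = co_segal_diagram.segal_comp M F (hd s) (hd t) (last t)"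
    if "s \<in> seqs X" "t \<in> seqs X" "last s = hd t" for s t
    using seqs_ends[OF that(1)] seqs_ends[OF that(2)] that by simp
  show "lmap2 (snd ?D) u = id2 M (lmap1 F [hd s, last s])" if "u \<in> Hom2 (SX X) s t" for u s t
    using const_diagram_lmap2[of u "segal_semicat M (X, F)" s t M] that seqs_ends[OF SX_Hom2D(1)[OF that]]
    by simp
qed

text \<open>Naturality in the sequence is \<open>lmap2_collapse_vcomp\<close> and compatibility with
  laxity is \<open>laxity_collapse\<close>. The Co-Segal condition makes each component
  invertible.\<close>

lemma segal_counit_iso:
  assumes D: "strict_co_segal M D"
  shows "diagram_morphism M (segal_counit M D)" "is_iso (StrictCoSegal M) (segal_counit M D)"
proof -
  obtain X F where XF: "D = (X, F)" by fastforce
  interpret F: co_segal_diagram M X F using D XF co_segal_diagram_iff bicategory_axioms by blast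
  obtain G where G: "const_diagram M (segal_semicat M (X, F)) = (X, G)" "lob G = lob F"
    "\<And>t. t \<in> seqs X \<Longrightarrow> lmap1 G t = lmap1 F [hd t, last t]"
    "\<And>s t. \<lbrakk>s \<in> seqs X; t \<in> seqs X; last s = hd t\<rbrakk> \<Longrightarrow> laxity G s t = F.segal_comp (hd s) (hd t) (last t)"
    "\<And>u s t. u \<in> Hom2 (SX X) s t \<Longrightarrow> lmap2 G u = id2 M (lmap1 F [hd s, last s])"
    using const_diagram_segal D XF by blast
  have cs: "strict_co_segal M (X, G)"
    using strict_co_segal_const_diagram[OF semi_category_segal] D XF G(1) by metis
  let ?h = "segal_counit M D"
  have d: "mdom ?h = (X, G)" "mcod ?h = (X, F)" "mfun ?h = (\<lambda>a \<in> X. a)"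
    "mfam ?h = (\<lambda>t \<in> seqs X. lmap2 F (collapse t))"
    using XF G(1) by simp_all
  show m: "diagram_morphism M ?h"
    unfolding diagram_morphism_iff[OF d(1,2)] d(3,4)
  proof (intro conjI allI ballI impI, goal_cases)
    case 1 then show ?case using cs by (simp add: strict_co_segal_def)
  next
    case 2 then show ?case using D XF by (simp add: strict_co_segal_def)
  next
    case (4 A) then show ?case using G by simp
  next
    case (5 t) then show ?case
      using F.lmap2_collapse_Hom2[OF 5] G(3)[OF 5] map_restrict_id[OF 5] by (simp del: map_eq_conv)
  next
    case (7 u s t)
    note s = SX_Hom2D[OF 7]
    show ?case
      using F.lmap2_collapse_vcomp[OF 7] G(5)[OF 7] vcomp_id[OF F.lmap2_collapse_Hom2[OF s(1)]] s
        map_seq_mor_id[OF 7] by simp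
  next
    case (8 s t)
    show ?case
      using F.laxity_collapse[OF 8] G(4)[OF 8] concat_seqs(1)[OF 8(1,2)] 8
        map_restrict_id[OF 8(1)] map_restrict_id[OF 8(2)] by (simp del: map_eq_conv)
  qed auto
  show "is_iso (StrictCoSegal M) ?h"
    by (rule is_iso_StrictCoSegal[OF m cs _ d(1-3), where n = "\<lambda>t. inv2 (lmap2 F (collapse t))"])
      (use D XF F.collapse_inverse2 in auto)
qed

section \<open>Functoriality, unit and counit\<close>

lemma is_functor_const:
  "is_functor (SemiCat M) (StrictCoSegal M) \<lparr>omap = const_diagram M, amap = const_arrow M\<rparr>"
  unfolding is_functor_def
proof (intro conjI ballI impI, goal_cases)
  case (1 A) then show ?case by (simp add: strict_co_segal_const_diagram)
next
  case (2 h) then show ?case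
    using strict_co_segal_const_diagram semi_functor.mdom semi_functor.mcod
    by (fastforce simp: hom_def diagram_morphism_const_arrow)
next
  case (3 A) then show ?case by (auto intro!: family_arrow_eqI restrict_ext simp: seqs_ends)
next
  case (4 h k)
  then interpret h: semi_functor M h by simp
  have f: "mfun h \<in> sset (mdom h) \<rightarrow> sset (mdom k)" using h.mfun 4 by auto
  show ?case
    by (rule family_arrow_eqI)
      (use 4 f in \<open>auto intro!: restrict_ext simp: seqs_ends map_seqs map_seq_ends\<close>)
qed

lemma is_functor_segal:
  "is_functor (StrictCoSegal M) (SemiCat M) \<lparr>omap = segal_semicat M, amap = segal_arrow M\<rparr>"
  unfolding is_functor_def
proof (intro conjI ballI impI, goal_cases)
  case (1 D) then show ?case using semi_category_segal[of "fst D" "snd D"] by simp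
next
  case (2 h) then show ?case by (simp add: hom_def semi_functor_segal_arrow)
next
  case (3 D) then show ?case by (auto intro!: family_arrow_eqI restrict_ext)
next
  case (4 h k)
  have f: "mfun h \<in> fst (mdom h) \<rightarrow> fst (mdom k)"
    using 4 diagram_morphism_iff[of h "fst (mdom h)" "snd (mdom h)" "fst (mcod h)" "snd (mcod h)" M] by auto
  show ?case
    by (rule family_arrow_eqI) (use 4 f in \<open>auto intro!: restrict_ext\<close>)
qed

text \<open>The composite functor equals the identity on objects and on arrows, so identity arrows
  can serve as components.\<close>

lemma nat_iso_unit:
  "nat_iso (SemiCat M) (SemiCat M) id_ftor
    (comp_ftor \<lparr>omap = segal_semicat M, amap = segal_arrow M\<rparr>
      \<lparr>omap = const_diagram M, amap = const_arrow M\<rparr>) (Id (SemiCat M))"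
proof -
  interpret S: category "SemiCat M" by (rule category_SemiCat)
  have "is_iso (SemiCat M) (Id (SemiCat M) A)" if A: "A \<in> Obj (SemiCat M)" for A
    using S.Id_hom[OF A] S.Comp_Id[OF S.Id_hom[OF A]] by (auto simp: is_iso_def hom_def)
  moreover have "Comp (SemiCat M) h (Id (SemiCat M) (mdom h)) = Comp (SemiCat M) (Id (SemiCat M) (mcod h)) h"
    if "semi_functor M h" for h
    using S.Comp_Id[of h "mdom h" "mcod h"] S.Id_Comp[of h "mdom h" "mcod h"] that by (simp add: hom_def)
  ultimately show ?thesis
    using S.Id_hom by (auto simp: nat_iso_def id_ftor_def comp_ftor_def segal_const_diagram segal_const_arrow)
qed

text \<open>At a sequence \<open>t\<close> the naturality square of the counit for \<open>h\<close>
  is the naturality square of the family \<open>mfam h\<close> at \<open>collapse t\<close>.\<close>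

lemma nat_iso_counit:
  "nat_iso (StrictCoSegal M) (StrictCoSegal M)
    (comp_ftor \<lparr>omap = const_diagram M, amap = const_arrow M\<rparr>
      \<lparr>omap = segal_semicat M, amap = segal_arrow M\<rparr>) id_ftor (segal_counit M)"
proof -
  have hom: "segal_counit M D \<in> hom (StrictCoSegal M) (const_diagram M (segal_semicat M D)) D"
    if "strict_co_segal M D" for D
    using that segal_counit_iso(1)[OF that]
      strict_co_segal_const_diagram[OF semi_category_segal[of "fst D" "snd D"]]
    by (simp add: hom_def)
  have "Comp (StrictCoSegal M) h (segal_counit M (mdom h))
      = Comp (StrictCoSegal M) (segal_counit M (mcod h)) (const_arrow M (segal_arrow M h))"
    if h: "diagram_morphism M h" "strict_co_segal M (mdom h)" "strict_co_segal M (mcod h)" for h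
  proof -
    obtain X F Y G where d: "mdom h = (X, F)" "mcod h = (Y, G)" by fastforce
    note hh = h(1)[unfolded diagram_morphism_iff[OF d]]
    have f: "mfun h \<in> X \<rightarrow> Y" using hh by (simp add: PiE_def)
    have nat: "\<And>u s t. u \<in> Hom2 (SX X) s t
        \<Longrightarrow> lmap2 G (map_seq_mor (mfun h) u) \<bullet> mfam h t = mfam h s \<bullet> lmap2 F u"
      using hh by blast
    show ?thesis
    proof (rule family_arrow_eqI)
      show "mfun (Comp (StrictCoSegal M) h (segal_counit M (mdom h)))
          = mfun (Comp (StrictCoSegal M) (segal_counit M (mcod h)) (const_arrow M (segal_arrow M h)))"
        by (rule extensionalityI[of _ X]) (use d f in \<open>auto simp: compose_def\<close>)
      show "mfam (Comp (StrictCoSegal M) h (segal_counit M (mdom h)))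
          = mfam (Comp (StrictCoSegal M) (segal_counit M (mcod h)) (const_arrow M (segal_arrow M h)))"
      proof (rule extensionalityI[of _ "seqs X"])
        fix t assume t: "t \<in> seqs X"
        show "mfam (Comp (StrictCoSegal M) h (segal_counit M (mdom h))) t
            = mfam (Comp (StrictCoSegal M) (segal_counit M (mcod h)) (const_arrow M (segal_arrow M h))) t"
          using nat[OF collapse_Hom2[OF t]] map_seq_mor_collapse[OF t, of "mfun h"] map_seqs[OF t f] t
            map_restrict_id[OF t] seqs_ends[OF t] by (simp add: d del: map_eq_conv)
      qed (simp_all add: d)
    qed simp_all
  qed
  then show ?thesis
    using hom segal_counit_iso by (auto simp: nat_iso_def id_ftor_def comp_ftor_def)
qed

end

text \<open>The conjuncts beyond \<open>is_equivalence\<close> keep the object data fixed: both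
  functors preserve the set \<open>X\<close>, the objects of \<open>M\<close> over it and the maps
  of object sets, and unit and counit are identities on elements of \<open>X\<close>. The
  equivalence thus restricts to each fixed choice of object data. The type \<open>'x\<close> is both
  the universe of small diagrams and the source of the object sets.\<close>

theorem proposition4p11:
  fixes M :: "('u, 'f, 'a) bicat" and W K F :: "'a set"
  assumes "special_quillen_algebra TYPE('x) M W K F"
  shows "\<exists>\<Phi> \<Psi> \<eta> \<epsilon>.
    is_equivalence
      (SemiCat M :: (('x, 'u, 'f, 'a) semicat, _) cat)
      (StrictCoSegal M :: (('x, 'u, 'f, 'a) diagram, _) cat) \<Phi> \<Psi> \<eta> \<epsilon> \<and>
    (\<forall>A \<in> Obj (SemiCat M). fst (omap \<Phi> A) = sset A \<and> lob (snd (omap \<Phi> A)) = sob A) \<and>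
    (\<forall>D \<in> Obj (StrictCoSegal M). sset (omap \<Psi> D) = fst D \<and> sob (omap \<Psi> D) = lob (snd D)) \<and>
    (\<forall>h \<in> Arr (SemiCat M). mfun (amap \<Phi> h) = mfun h) \<and>
    (\<forall>k \<in> Arr (StrictCoSegal M). mfun (amap \<Psi> k) = mfun k) \<and>
    (\<forall>A \<in> Obj (SemiCat M). mfun (\<eta> A) = (\<lambda>a \<in> sset A. a)) \<and>
    (\<forall>D \<in> Obj (StrictCoSegal M). mfun (\<epsilon> D) = (\<lambda>a \<in> fst D. a))"
proof -
  interpret bicategory M using assms by (rule special_quillen_algebra.axioms(1))
  show ?thesis
    using category_SemiCat category_StrictCoSegal is_functor_const is_functor_segal
      nat_iso_unit nat_iso_counit
    by (intro exI[of _ "\<lparr>omap = const_diagram M, amap = const_arrow M\<rparr>"]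
        exI[of _ "\<lparr>omap = segal_semicat M, amap = segal_arrow M\<rparr>"]
        exI[of _ "Id (SemiCat M)"] exI[of _ "segal_counit M"])
      (auto simp: is_equivalence_def)
qed

end
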